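(* For every $\mu>0$, the weighted Bergman spaces $\widetilde A^2_\mu$ and $A^2_{\frac{1-\mu}2}$ agree up to equivalence of norms: they consist of the same functions on $\mathbb Z^2_+$, and the norms $\|\cdot\|_{\widetilde A^2_\mu}$ and $\|\cdot\|_{A^2_{(1-\mu)/2}}$ are equivalent.
   Context: Lattice points $(m,n)\in\mathbb Z^2$ are identified with $m+in\in\mathbb C$. Let $\mathbb Z^2_+=\{m+in: m,n\in\mathbb Z,\ n\geqslant 0\}$. A function $f:\mathbb Z^2_+\to\mathbb C$ is discrete holomorphic, written $f\in\operatorname{Hol}(\mathbb Z^2_+)$, if $f(z)+i f(z+1)-f(z+1+i)-i f(z+i)=0$ for every $z\in\mathbb Z^2_+$. The (unweighted) Bergman kernel on the diagonal is $$B_{m+in}(m+in)=\frac1{2\pi}\int_0^\pi\Big(\frac{\cos t}{1+\sin t}\Big)^{2n}\frac{2\sin t}{1+\sin t}\,dt>0,\qquad m+in\in\mathbb Z^2_+.$$ For $\nu\in\mathbb R$, $A^2_\nu$ is the space of all $f\in\operatorname{Hol}(\mathbb Z^2_+)$ with $$\|f\|_{A^2_\nu}^2=\sum_{n=0}^{+\infty}\sum_{m=-\infty}^{+\infty}|f(m+in)|^2\,\big(B_{m+in}(m+in)\big)^\nu<\infty.$$ For $\mu>0$, let $X_\mu$ be the space of measurable $g$ on $[-\pi,\pi]$ vanishing a.e. on $(-\pi,0)$ with $\|g\|_{X_\mu}^2=\int_0^\pi|g(t)|^2\big(\frac{1+\sin t}{2\sin t}\big)^\mu dt<\infty$ (so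 $X_\mu\subseteq L^2$). The space $\widetilde A^2_\mu=\mathcal F^{-1}(X_\mu)$ is the set of functions on $\mathbb Z^2_+$ of the form $$f(m+in)=\frac1{\sqrt{2\pi}}\int_0^\pi g(t)e^{imt}\Big(\frac{\cos t}{1+\sin t}\Big)^n dt,\qquad g\in X_\mu,$$ with norm $\|f\|_{\widetilde A^2_\mu}=\|g\|_{X_\mu}$. *)

theory Defs
  imports "HOL-Analysis.Analysis"
begin

text \<open>The pair \<open>(m, n)\<close> stands for the lattice point \<open>m + in\<close> with \<open>n \<ge> 0\<close>.\<close>

type_synonym half_lattice = "int \<times> nat"

definition Hol :: "(half_lattice \<Rightarrow> complex) set" where
  "Hol = {f. \<forall>m n. f (m, n) + \<i> * f (m + 1, n) - f (m + 1, n + 1) - \<i> * f (m, n + 1) = 0}"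

definition bergman_diag :: "half_lattice \<Rightarrow> real" where
  "bergman_diag = (\<lambda>(m, n). 1 / (2 * pi) *
     (LBINT t:{0..pi}. (cos t / (1 + sin t)) ^ (2 * n) * (2 * sin t / (1 + sin t))))"

definition A2_normsq :: "real \<Rightarrow> (half_lattice \<Rightarrow> complex) \<Rightarrow> ennreal" where
  "A2_normsq \<nu> f =
     (\<Sum>n. \<Sum>\<^sub>\<infinity>m. ennreal ((cmod (f (m, n)))\<^sup>2 * bergman_diag (m, n) powr \<nu>))"

definition A2 :: "real \<Rightarrow> (half_lattice \<Rightarrow> complex) set" where
  "A2 \<nu> = {f \<in> Hol. A2_normsq \<nu> f < \<infinity>}"

definition A2_norm :: "real \<Rightarrow> (half_lattice \<Rightarrow> complex) \<Rightarrow> real" where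
  "A2_norm \<nu> f = sqrt (enn2real (A2_normsq \<nu> f))"

definition X_normsq :: "real \<Rightarrow> (real \<Rightarrow> complex) \<Rightarrow> ennreal" where
  "X_normsq \<mu> g =
     (\<integral>\<^sup>+t\<in>{0..pi}. ennreal ((cmod (g t))\<^sup>2 * ((1 + sin t) / (2 * sin t)) powr \<mu>) \<partial>lebesgue)"

text \<open>Elements of \<open>X \<mu>\<close> are functions rather than classes of functions equal almost everywhere;
  their values outside \<open>[-\<pi>, \<pi>]\<close> are irrelevant.\<close>

definition X :: "real \<Rightarrow> (real \<Rightarrow> complex) set" where
  "X \<mu> = {g. g \<in> borel_measurable (lebesgue_on {-pi..pi}) \<and>
             (AE t in lebesgue. t \<in> {-pi<..<0} \<longrightarrow> g t = 0) \<and>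
             X_normsq \<mu> g < \<infinity>}"

definition X_norm :: "real \<Rightarrow> (real \<Rightarrow> complex) \<Rightarrow> real" where
  "X_norm \<mu> g = sqrt (enn2real (X_normsq \<mu> g))"

definition inv_fourier :: "(real \<Rightarrow> complex) \<Rightarrow> half_lattice \<Rightarrow> complex" where
  "inv_fourier g = (\<lambda>(m, n). complex_of_real (1 / sqrt (2 * pi)) *
     (LINT t:{0..pi}|lebesgue. g t * exp (\<i> * of_int m * of_real t) *
        of_real (cos t / (1 + sin t)) ^ n))"

definition tilde_A2 :: "real \<Rightarrow> (half_lattice \<Rightarrow> complex) set" where
  "tilde_A2 \<mu> = inv_fourier ` X \<mu>"

text \<open>The choice of the representing function does not matter: on the row \<open>n = 0\<close>, the values of
  \<open>inv_fourier g\<close> are, up to normalization, all the Fourier coefficients of \<open>g\<close>, so \<open>g\<close> is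
  determined almost everywhere.\<close>

definition tilde_A2_norm :: "real \<Rightarrow> (half_lattice \<Rightarrow> complex) \<Rightarrow> real" where
  "tilde_A2_norm \<mu> f = X_norm \<mu> (SOME g. g \<in> X \<mu> \<and> f = inv_fourier g)"

end

theory Submission
  imports Defs
begin

text \<open>On the row \<open>n\<close>, a discrete holomorphic function has the symbol \<open>g q\<^sup>n\<close> with
  \<open>q(t) = cos t / (1 + sin t)\<close>, so by Parseval its norm in \<open>A2 \<nu>\<close> is the \<open>L\<^sup>2\<close> norm of \<open>g\<close> with
  the weight \<open>W = (\<Sum>n. B\<^sub>n\<^sup>\<nu> q\<^sup>2\<^sup>n)\<close>, where \<open>B\<^sub>n\<close> is the diagonal Bergman kernel. Since
  \<open>B\<^sub>n\<close> is comparable to \<open>(n + 1)\<close> to the power \<open>-2\<close>, for \<open>\<nu> = (1 - \<mu>) / 2\<close> the coefficients of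
  \<open>W\<close> are comparable to the binomial coefficients of \<open>(1 - q\<^sup>2)\<close> to the power \<open>-\<mu>\<close>, and
  \<open>1 - q\<^sup>2 = 2 sin t / (1 + sin t)\<close>. On \<open>(-\<pi>, 0)\<close> one has \<open>q\<^sup>2 \<ge> 1\<close> and \<open>W = \<infinity>\<close>, which
  forces \<open>g\<close> to vanish there.\<close>

section \<open>Fourier coefficients on the circle\<close>

text \<open>The two inclusions differ in depth. From a symbol in \<open>X \<mu>\<close> to a
  function, everything is pointwise: \<open>q^2 < 1\<close> on (0, pi) keeps all rows in L^2, and
  neighbouring symbols satisfy an identity for each t. From a function in \<open>A2\<close> to a
  symbol, only summability of the rows is given: each row has its own L^2 symbol, and only discrete
  holomorphy together with uniqueness of Fourier coefficients forces these symbols to have the form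
  \<open>g q^n\<close>. Hence the completeness of the trigonometric system is established first,
  from Stone-Weierstrass on the unit circle. The size of \<open>B_n\<close> rests on
  \<open>q' = -1 / (1 + sin t)\<close>: a bounded factor \<open>1 / (1 + sin t)\<close> turns its
  integrand into an exact derivative. The size of the binomial coefficients is Euler's limit for
  Gamma. All coefficients are nonnegative, so termwise comparison passes to \<open>W\<close>. Norms
  are computed in \<open>ennreal\<close>, so that \<open>W = \<infinity>\<close> can be used as
  information about \<open>g\<close>. The two-sided estimate is shown for every representing
  \<open>g\<close>, hence for the one that \<open>SOME\<close> picks.\<close>

abbreviation circ :: "real measure" where "circ \<equiv> lebesgue_on {-pi..pi}"

lemma emeasure_circ: "emeasure circ (space circ) = ennreal (2 * pi)"
  by (simp add: emeasure_restrict_space)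

interpretation circ: finite_measure circ
  by (rule finite_measureI) (simp only: emeasure_circ, simp)

lemma measurable_circ_cis [measurable]: "(\<lambda>t. cis (c * t)) \<in> borel_measurable circ"
  by (rule continuous_imp_measurable_on_sets_lebesgue) (auto intro!: continuous_intros)

lemma integrable_mult_bounded:
  fixes g h :: "'a \<Rightarrow> complex"
  assumes g: "integrable M g" and h: "h \<in> borel_measurable M" and b: "\<And>t. t \<in> space M \<Longrightarrow> cmod (h t) \<le> B"
  shows "integrable M (\<lambda>t. g t * h t)"
proof (rule Bochner_Integration.integrable_bound)
  show "integrable M (\<lambda>t. B * cmod (g t))" using g by auto
  show "(\<lambda>t. g t * h t) \<in> borel_measurable M" using g h by auto
  show "AE t in M. cmod (g t * h t) \<le> norm (B * cmod (g t))"
  proof (rule AE_I2)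
    fix t assume "t \<in> space M"
    from b[OF this] have "cmod (g t) * cmod (h t) \<le> cmod (g t) * B"
      by (intro mult_left_mono) auto
    then show "cmod (g t * h t) \<le> norm (B * cmod (g t))"
      by (simp add: norm_mult abs_mult mult.commute)
        (smt (verit, best) mult_right_mono norm_ge_zero)
  qed
qed

lemma integrable_mult_cis:
  "integrable circ g \<Longrightarrow> integrable circ (\<lambda>t. g t * cis (c * t))"
  by (rule integrable_mult_bounded[where B = 1]) auto

lemma integral_circ_cis:
  "(\<integral>t. cis (real_of_int k * t) \<partial>circ) = (if k = 0 then of_real (2 * pi) else 0)"
proof (cases "k = 0")
  case True
  then show ?thesis by (simp add: measure_def emeasure_circ[simplified] scaleR_conv_of_real)
next
  case False
  have int: "integrable circ (\<lambda>t. cis (real_of_int k * t))"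
    using integrable_mult_cis[of "\<lambda>_. 1" "real_of_int k"] by simp
  have "((\<lambda>t. cis (real_of_int k * t)) has_integral
     (cis (real_of_int k * pi) / (\<i> * of_int k) - cis (real_of_int k * (-pi)) / (\<i> * of_int k))) {-pi..pi}"
  proof (rule fundamental_theorem_of_calculus)
    fix t :: real
    have "((\<lambda>t. exp (\<i> * of_int k * of_real t) / (\<i> * of_int k)) has_vector_derivative
       exp (\<i> * of_int k * of_real t)) (at t within {-pi..pi})"
    proof (rule has_vector_derivative_real_field)
      show "((\<lambda>z. exp (\<i> * of_int k * z) / (\<i> * of_int k)) has_field_derivative
        exp (\<i> * of_int k * of_real t)) (at (of_real t))"
        using False by (auto intro!: derivative_eq_intros)
    qed
    then show "((\<lambda>t. cis (real_of_int k * t) / (\<i> * of_int k)) has_vector_derivative cis (real_of_int k * t)) (at t within {-pi..pi})"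
      by (simp add: cis_conv_exp mult.assoc)
  qed simp
  moreover have "cis (real_of_int k * pi) = cis (real_of_int k * (-pi))"
    by (simp add: complex_eq_iff sin_times_pi_eq_0 mult.commute)
  ultimately have "((\<lambda>t. cis (real_of_int k * t)) has_integral 0) {-pi..pi}" by simp
  with has_integral_integral_lebesgue_on[OF int] False show ?thesis
    by (auto dest: has_integral_unique)
qed

text \<open>The sign of the exponent follows \<^const>\<open>inv_fourier\<close>, so these are the usual Fourier
  coefficients at \<open>-m\<close>.\<close>

definition fcoef :: "(real \<Rightarrow> complex) \<Rightarrow> int \<Rightarrow> complex" where
  "fcoef g m = of_real (1 / sqrt (2 * pi)) * (\<integral>t. g t * cis (of_int m * t) \<partial>circ)"

section \<open>Square-integrable functions on the circle\<close>

definition sq_int :: "(real \<Rightarrow> complex) \<Rightarrow> bool" where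
  "sq_int g \<longleftrightarrow> g \<in> borel_measurable circ \<and> integrable circ (\<lambda>t. (cmod (g t))\<^sup>2)"

lemma sq_int_iff_nn:
  "sq_int g \<longleftrightarrow> g \<in> borel_measurable circ \<and> (\<integral>\<^sup>+t. ennreal ((cmod (g t))\<^sup>2) \<partial>circ) < \<infinity>"
  by (auto simp: sq_int_def integrable_iff_bounded)

lemma sq_int_mult_integrable:
  assumes "sq_int g" "sq_int h"
  shows "integrable circ (\<lambda>t. g t * h t)"
proof (rule Bochner_Integration.integrable_bound)
  show "integrable circ (\<lambda>t. (cmod (g t))\<^sup>2 + (cmod (h t))\<^sup>2)" using assms by (auto simp: sq_int_def)
  show "(\<lambda>t. g t * h t) \<in> borel_measurable circ" using assms by (auto simp: sq_int_def)
  have "a * b \<le> a\<^sup>2 + b\<^sup>2" if "a \<ge> 0" "b \<ge> 0" for a b :: real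
    using sum_squares_bound[of a b] mult_nonneg_nonneg[OF that] by linarith
  then show "AE t in circ. cmod (g t * h t) \<le> norm ((cmod (g t))\<^sup>2 + (cmod (h t))\<^sup>2)"
    by (simp add: norm_mult)
qed

lemma sq_int_bounded:
  assumes "h \<in> borel_measurable circ" "\<And>t. t \<in> space circ \<Longrightarrow> cmod (h t) \<le> B"
  shows "sq_int h"
  unfolding sq_int_def
proof
  show "integrable circ (\<lambda>t. (cmod (h t))\<^sup>2)"
    by (rule circ.integrable_const_bound[where B = "B\<^sup>2"])
      (use assms in \<open>auto intro!: AE_I2 power_mono\<close>)
qed (use assms in auto)

lemma sq_int_integrable: "sq_int g \<Longrightarrow> integrable circ g"
  using sq_int_mult_integrable[of g "\<lambda>_. 1"] sq_int_bounded[of "\<lambda>_. 1" 1] by simp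

lemma sq_int_mult_bounded:
  assumes g: "sq_int g" and h: "h \<in> borel_measurable circ" and b: "\<And>t. t \<in> space circ \<Longrightarrow> cmod (h t) \<le> B"
  shows "sq_int (\<lambda>t. g t * h t)"
  unfolding sq_int_def
proof
  show "integrable circ (\<lambda>t. (cmod (g t * h t))\<^sup>2)"
  proof (rule Bochner_Integration.integrable_bound)
    show "integrable circ (\<lambda>t. B\<^sup>2 * (cmod (g t))\<^sup>2)" using g by (auto simp: sq_int_def)
    show "(\<lambda>t. (cmod (g t * h t))\<^sup>2) \<in> borel_measurable circ" using g h by (auto simp: sq_int_def)
    show "AE t in circ. norm ((cmod (g t * h t))\<^sup>2) \<le> norm (B\<^sup>2 * (cmod (g t))\<^sup>2)"
      using b by (intro AE_I2) (auto simp: norm_mult power_mult_distrib mult.commute[of "B\<^sup>2"] intro!: mult_left_mono power_mono)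
  qed
qed (use g h in \<open>auto simp: sq_int_def\<close>)

lemma fcoef_diff:
  assumes "integrable circ g" "integrable circ h"
  shows "fcoef (\<lambda>t. g t - h t) m = fcoef g m - fcoef h m"
  unfolding fcoef_def using integrable_mult_cis[OF assms(1)] integrable_mult_cis[OF assms(2)]
  by (simp add: ring_distribs left_diff_distrib right_diff_distrib add_divide_distrib diff_divide_distrib)

lemma fcoef_add:
  assumes "integrable circ g" "integrable circ h"
  shows "fcoef (\<lambda>t. g t + h t) m = fcoef g m + fcoef h m"
  unfolding fcoef_def using integrable_mult_cis[OF assms(1)] integrable_mult_cis[OF assms(2)]
  by (simp add: ring_distribs left_diff_distrib right_diff_distrib add_divide_distrib diff_divide_distrib)

lemma fcoef_cmult: "fcoef (\<lambda>t. c * g t) m = c * fcoef g m"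
  unfolding fcoef_def by (simp add: mult.assoc mult.left_commute)

lemma fcoef_mult_cis: "fcoef (\<lambda>t. g t * cis t) m = fcoef g (m + 1)"
  unfolding fcoef_def
  by (simp add: mult.assoc cis_mult ring_distribs add.commute)

lemma fcoef_cong_AE:
  assumes "AE t in circ. g t = h t" "g \<in> borel_measurable circ" "h \<in> borel_measurable circ"
  shows "fcoef g m = fcoef h m"
  unfolding fcoef_def using assms
  by (auto intro!: arg_cong[where f="(*) _"] integral_cong_AE)

section \<open>Trigonometric polynomials and Bessel's inequality\<close>

text \<open>The minus sign in the exponent answers the plus sign in \<open>fcoef\<close>, and the
  factor normalizes the exponentials in L^2, so that \<open>fcoef\<close> returns the coefficients
  \<open>a\<close> unchanged.\<close>

definition trig_sum :: "(int \<Rightarrow> complex) \<Rightarrow> int set \<Rightarrow> real \<Rightarrow> complex" where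
  "trig_sum a F t = of_real (1 / sqrt (2 * pi)) * (\<Sum>m\<in>F. a m * cis (- of_int m * t))"

lemma sq_int_trig_sum: "sq_int (trig_sum a F)"
proof (rule sq_int_bounded)
  show "trig_sum a F \<in> borel_measurable circ" unfolding trig_sum_def
    by measurable
  show "cmod (trig_sum a F t) \<le> 1 / sqrt (2 * pi) * (\<Sum>m\<in>F. cmod (a m))" for t
    unfolding trig_sum_def norm_mult by (intro mult_mono order_trans[OF norm_sum]) (auto simp: norm_mult norm_divide)
qed

lemma fcoef_trig_sum:
  assumes "finite F"
  shows "fcoef (trig_sum a F) m = (if m \<in> F then a m else 0)"
proof -
  have sq: "complex_of_real (1 / sqrt (2 * pi)) * of_real (1 / sqrt (2 * pi)) * of_real (2 * pi) = 1"
    unfolding of_real_mult[symmetric] by (simp add: field_simps del: of_real_mult)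
  have "(\<integral>t. trig_sum a F t * cis (of_int m * t) \<partial>circ) =
    (\<integral>t. of_real (1 / sqrt (2 * pi)) * (\<Sum>k\<in>F. a k * cis (of_int (m - k) * t)) \<partial>circ)"
    unfolding trig_sum_def
    by (intro Bochner_Integration.integral_cong refl) (simp add: sum_distrib_right mult.assoc cis_mult left_diff_distrib)
  also have "\<dots> = of_real (1 / sqrt (2 * pi)) * (\<Sum>k\<in>F. a k * (\<integral>t. cis (of_int (m - k) * t) \<partial>circ))"
    using integrable_mult_cis[of "\<lambda>_. 1"]
    by (subst integral_mult_right_zero, subst Bochner_Integration.integral_sum) auto
  also have "\<dots> = of_real (1 / sqrt (2 * pi)) * (\<Sum>k\<in>F. if k = m then a k * of_real (2 * pi) else 0)"
    by (intro arg_cong[where f="(*) _"] sum.cong refl, subst integral_circ_cis) auto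
  also have "\<dots> = of_real (1 / sqrt (2 * pi)) * (if m \<in> F then a m * of_real (2 * pi) else 0)"
    using assms by (simp add: sum.delta)
  finally show ?thesis unfolding fcoef_def using sq by (auto simp: mult_ac)
qed

lemma integral_mult_cnj_trig_sum:
  assumes "integrable circ g" "finite F"
  shows "(\<integral>t. g t * cnj (trig_sum a F t) \<partial>circ) = (\<Sum>m\<in>F. fcoef g m * cnj (a m))"
proof -
  have "(\<integral>t. g t * cnj (trig_sum a F t) \<partial>circ) =
    (\<integral>t. of_real (1 / sqrt (2 * pi)) * (\<Sum>m\<in>F. cnj (a m) * (g t * cis (of_int m * t))) \<partial>circ)"
    unfolding trig_sum_def
    by (intro Bochner_Integration.integral_cong refl) (simp add: sum_distrib_left mult_ac cis_cnj)
  also have "\<dots> = of_real (1 / sqrt (2 * pi)) * (\<Sum>m\<in>F. cnj (a m) * (\<integral>t. g t * cis (of_int m * t) \<partial>circ))"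
    using integrable_mult_cis[OF assms(1)]
    by (subst integral_mult_right_zero, subst Bochner_Integration.integral_sum) auto
  finally show ?thesis by (simp add: fcoef_def sum_distrib_left mult_ac)
qed

lemma integral_trig_sum_sq:
  assumes "finite F"
  shows "(\<integral>t. (cmod (trig_sum a F t))\<^sup>2 \<partial>circ) = (\<Sum>m\<in>F. (cmod (a m))\<^sup>2)"
proof -
  have "complex_of_real (\<integral>t. (cmod (trig_sum a F t))\<^sup>2 \<partial>circ) = (\<integral>t. of_real ((cmod (trig_sum a F t))\<^sup>2) \<partial>circ)"
    by (rule integral_complex_of_real[symmetric])
  also have "\<dots> = (\<integral>t. trig_sum a F t * cnj (trig_sum a F t) \<partial>circ)"
    by (intro Bochner_Integration.integral_cong refl) (simp add: complex_norm_square[symmetric])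
  also have "\<dots> = (\<Sum>m\<in>F. a m * cnj (a m))"
    using integral_mult_cnj_trig_sum[OF sq_int_integrable[OF sq_int_trig_sum] assms] fcoef_trig_sum[OF assms]
    by simp
  also have "\<dots> = complex_of_real (\<Sum>m\<in>F. (cmod (a m))\<^sup>2)"
    by (simp add: complex_norm_square[symmetric])
  finally show ?thesis by (simp only: of_real_eq_iff)
qed

text \<open>The polynomial \<open>p\<close> is the orthogonal projection of \<open>g\<close> to the
  span of the exponentials indexed by \<open>F\<close>. In the expansion of the squared norm of
  \<open>g - p\<close>, the inner product of \<open>g\<close> with \<open>p\<close> and the squared
  norm of \<open>p\<close> both equal the sum on the left.\<close>

lemma Bessel_inequality:
  assumes g: "sq_int g" and F: "finite F"
  shows "(\<Sum>m\<in>F. (cmod (fcoef g m))\<^sup>2) \<le> (\<integral>t. (cmod (g t))\<^sup>2 \<partial>circ)"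
proof -
  define p where "p = trig_sum (fcoef g) F"
  have p: "sq_int p" unfolding p_def by (rule sq_int_trig_sum)
  have cp: "sq_int (\<lambda>t. cnj (p t))" using p measurable_compose[OF _ borel_measurable_continuous_onI[OF continuous_on_cnj[OF continuous_on_id]], of p]
    by (auto simp: sq_int_def)
  have ig: "integrable circ (\<lambda>t. (cmod (g t))\<^sup>2)" and ip: "integrable circ (\<lambda>t. (cmod (p t))\<^sup>2)"
    using g p by (auto simp: sq_int_def)
  have igp: "integrable circ (\<lambda>t. g t * cnj (p t))" by (rule sq_int_mult_integrable[OF g cp])
  have "0 \<le> (\<integral>t. (cmod (g t - p t))\<^sup>2 \<partial>circ)" by simp
  also have "\<dots> = (\<integral>t. (cmod (g t))\<^sup>2 - 2 * Re (g t * cnj (p t)) + (cmod (p t))\<^sup>2 \<partial>circ)"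
    by (intro Bochner_Integration.integral_cong refl, unfold cmod_power2) (simp add: power2_eq_square algebra_simps)
  also have "\<dots> = (\<integral>t. (cmod (g t))\<^sup>2 \<partial>circ) - 2 * Re (\<integral>t. g t * cnj (p t) \<partial>circ) + (\<integral>t. (cmod (p t))\<^sup>2 \<partial>circ)"
    using ig ip igp by (simp del: times_complex.sel)
  also have "(\<integral>t. g t * cnj (p t) \<partial>circ) = (\<Sum>m\<in>F. of_real ((cmod (fcoef g m))\<^sup>2))"
    unfolding p_def using integral_mult_cnj_trig_sum[OF sq_int_integrable[OF g] F]
    by (simp add: complex_norm_square[symmetric])
  also have "(\<integral>t. (cmod (p t))\<^sup>2 \<partial>circ) = (\<Sum>m\<in>F. (cmod (fcoef g m))\<^sup>2)"
    unfolding p_def by (rule integral_trig_sum_sq[OF F])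
  finally show ?thesis by simp
qed

section \<open>Uniqueness of Fourier coefficients\<close>

text \<open>Integrability has to be demanded: the integral of a non-integrable function is 0 by
  convention, so such a function would have vanishing coefficients for a spurious reason.\<close>

definition fcoef_null :: "(real \<Rightarrow> complex) \<Rightarrow> bool" where
  "fcoef_null g \<longleftrightarrow> integrable circ g \<and> (\<forall>m. fcoef g m = 0)"

lemma fcoef_null_cmult: "fcoef_null g \<Longrightarrow> fcoef_null (\<lambda>t. c * g t)"
  by (auto simp: fcoef_null_def fcoef_cmult)

lemma fcoef_null_add: "fcoef_null g \<Longrightarrow> fcoef_null h \<Longrightarrow> fcoef_null (\<lambda>t. g t + h t)"
  by (auto simp: fcoef_null_def fcoef_add)

lemma fcoef_null_mult_cis: "fcoef_null g \<Longrightarrow> fcoef_null (\<lambda>t. g t * cis (of_int k * t))"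
  unfolding fcoef_null_def
proof (intro conjI allI)
  fix m assume g: "integrable circ g \<and> (\<forall>m. fcoef g m = 0)"
  then show "integrable circ (\<lambda>t. g t * cis (of_int k * t))"
    by (auto intro: integrable_mult_cis)
  have "fcoef (\<lambda>t. g t * cis (of_int k * t)) m = fcoef g (k + m)"
    by (simp add: fcoef_def mult.assoc cis_mult ring_distribs)
  with g show "fcoef (\<lambda>t. g t * cis (of_int k * t)) m = 0" by simp
qed

text \<open>Formulated for multipliers of all null functions \<open>g\<close> at once, so that the product case of the
  induction is a composition.\<close>

lemma fcoef_null_mult_polynomial:
  assumes "real_polynomial_function p"
  shows "fcoef_null g \<Longrightarrow> fcoef_null (\<lambda>t. of_real (p (cis t)) * g t)"
  using assms
proof (induction p arbitrary: g rule: real_polynomial_function.induct)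
  case (linear f)
  interpret bounded_linear f by fact
  have f: "f z = Re z * f 1 + Im z * f \<i>" for z
  proof -
    have "z = Re z *\<^sub>R 1 + Im z *\<^sub>R \<i>" by (simp add: complex_eq_iff)
    then have "f z = f (Re z *\<^sub>R 1 + Im z *\<^sub>R \<i>)" by (rule arg_cong)
    then show ?thesis by (simp only: add scaleR) simp
  qed
  \<comment> \<open>On the circle Re z = (z + 1/z)/2 and Im z = (z - 1/z)/(2 \<i>); \<open>c\<close>
    and \<open>d\<close> collect the coefficients of z and 1/z.\<close>
  define c where "c = complex_of_real (f 1) / 2 + of_real (f \<i>) / (2 * \<i>)"
  define d where "d = complex_of_real (f 1) / 2 - of_real (f \<i>) / (2 * \<i>)"
  have "of_real (f (cis t)) * g t = c * (g t * cis (of_int 1 * t)) + d * (g t * cis (of_int (-1) * t))" for t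
    by (subst f) (simp add: c_def d_def complex_eq_iff field_simps)
  then show ?case
    by (simp only:) (intro fcoef_null_add fcoef_null_cmult fcoef_null_mult_cis linear.prems)
next
  case (const c)
  then show ?case by (rule fcoef_null_cmult)
next
  case (add f h)
  show ?case using fcoef_null_add[OF add.IH(1)[OF add.prems] add.IH(2)[OF add.prems]]
    by (simp add: ring_distribs)
next
  case (mult f h)
  show ?case using mult.IH(1)[OF mult.IH(2)[OF mult.prems]] by (simp add: mult.assoc)
qed

section \<open>Completeness: testing against continuous periodic functions\<close>

text \<open>\<open>Arg2pi\<close> jumps across the positive real axis. The reflection
  \<open>- z\<close> moves the jump to z = -1, that is to the ends of [-pi, pi], where the equal
  values of \<open>\<phi>\<close> close the gap.\<close>

lemma continuous_on_circle_Arg2pi: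
  fixes \<phi> :: "real \<Rightarrow> 'a::real_normed_vector"
  assumes "continuous_on {-pi..pi} \<phi>" "\<phi> (-pi) = \<phi> pi"
  shows "continuous_on (sphere 0 1) (\<lambda>z. \<phi> (Arg2pi (- z) - pi))"
proof -
  define p where "p s = \<phi> (2 * pi * s - pi)" for s
  have im: "2 * pi * s - pi \<in> {-pi..pi}" if "s \<in> {0..1}" for s
    using that by (auto simp: mult_le_cancel_left1)
  have "path p" unfolding path_def p_def
    by (rule continuous_on_compose2[OF assms(1)]) (use im in \<open>auto intro!: continuous_intros\<close>)
  \<comment> \<open>The trivial homotopy of the loop with itself is only a vehicle: the transfer
    from loops to maps of the circle delivers continuity of the circle map.\<close>
  then have "homotopic_loops UNIV p p"
    using assms(2) by (auto simp: homotopic_loops_refl p_def pathfinish_def pathstart_def)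
  then have "continuous_on (sphere 0 1) (p \<circ> (\<lambda>z. Arg2pi z / (2 * pi)))"
    using homotopic_loops_imp_homotopic_circlemaps homotopic_with_imp_continuous by blast
  then have "continuous_on (uminus ` sphere 0 1) (p \<circ> (\<lambda>z. Arg2pi z / (2 * pi)))"
    by (rule continuous_on_subset) auto
  from continuous_on_compose[OF continuous_on_minus[OF continuous_on_id] this]
  show ?thesis by (simp add: p_def o_def)
qed

lemma Arg2pi_minus_cis:
  assumes "t \<in> {-pi..<pi}" shows "Arg2pi (- cis t) - pi = t"
proof -
  have "Arg2pi (- cis t) = t + pi"
  proof (rule Arg2pi_unique)
    show "complex_of_real 1 * exp (\<i> * complex_of_real (t + pi)) = - cis t"
      by (simp only: cis_conv_exp[symmetric]) (simp add: complex_eq_iff)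
  qed (use assms in auto)
  then show ?thesis by simp
qed

lemma AE_circ_neq: "AE t in circ. t \<noteq> a"
proof -
  have "AE t in lebesgue. t \<noteq> a"
    by (rule AE_completion) (rule AE_lborel_singleton)
  then show ?thesis by (subst AE_restrict_space_iff) auto
qed

lemma integrable_mult_continuous:
  fixes \<phi> :: "real \<Rightarrow> real" and g :: "real \<Rightarrow> complex"
  assumes "integrable circ g" "continuous_on {-pi..pi} \<phi>"
  shows "integrable circ (\<lambda>t. of_real (\<phi> t) * g t)"
proof -
  have \<phi>_meas: "\<phi> \<in> borel_measurable circ"
    by (rule continuous_imp_measurable_on_sets_lebesgue[OF assms(2)]) auto
  have "bounded (\<phi> ` {-pi..pi})"
    using compact_imp_bounded[OF compact_continuous_image[OF assms(2) compact_Icc]] .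
  then obtain B where "\<forall>t\<in>{-pi..pi}. \<bar>\<phi> t\<bar> \<le> B"
    by (auto simp: bounded_iff)
  then show ?thesis
    using integrable_mult_bounded[OF assms(1), of "\<lambda>t. of_real (\<phi> t)" B] \<phi>_meas
    by (auto simp: mult.commute)
qed

text \<open>Transported to the unit circle, \<open>\<phi>\<close> is a uniform limit of real
  polynomials in Re z and Im z. Their products with \<open>g\<close> integrate to 0, and the error
  is at most \<open>e\<close> times the L^1 norm of \<open>g\<close>.\<close>

lemma fcoef_null_imp_integral_continuous_eq_0:
  fixes \<phi> :: "real \<Rightarrow> real"
  assumes g: "fcoef_null g" and cont: "continuous_on {-pi..pi} \<phi>" and per: "\<phi> (-pi) = \<phi> pi"
  shows "(\<integral>t. of_real (\<phi> t) * g t \<partial>circ) = 0"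
proof -
  define \<psi> where "\<psi> z = \<phi> (Arg2pi (- z) - pi)" for z
  have c\<psi>: "continuous_on (sphere 0 1) \<psi>"
    unfolding \<psi>_def by (rule continuous_on_circle_Arg2pi[OF cont per])
  have \<psi>: "\<psi> (cis t) = \<phi> t" if "t \<in> {-pi..<pi}" for t
    unfolding \<psi>_def using Arg2pi_minus_cis[OF that] by simp
  have g_int: "integrable circ g" using g by (simp add: fcoef_null_def)
  have \<phi>g: "integrable circ (\<lambda>t. of_real (\<phi> t) * g t)"
    by (rule integrable_mult_continuous[OF g_int cont])
  have *: "cmod (\<integral>t. of_real (\<phi> t) * g t \<partial>circ) \<le> e * (\<integral>t. cmod (g t) \<partial>circ)" if e: "e > 0" for e
  proof -
    obtain p where p: "real_polynomial_function p" "\<And>x. x \<in> sphere 0 1 \<Longrightarrow> \<bar>\<psi> x - p x\<bar> < e"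
      using Stone_Weierstrass_real_polynomial_function[OF compact_sphere c\<psi> e] by blast
    have pg: "fcoef_null (\<lambda>t. of_real (p (cis t)) * g t)"
      by (rule fcoef_null_mult_polynomial[OF p(1) g])
    then have pgi: "integrable circ (\<lambda>t. of_real (p (cis t)) * g t)" by (simp add: fcoef_null_def)
    have "fcoef (\<lambda>t. of_real (p (cis t)) * g t) 0 = 0" using pg by (simp add: fcoef_null_def)
    then have "(\<integral>t. of_real (p (cis t)) * g t \<partial>circ) = 0" by (simp add: fcoef_def)
    then have "(\<integral>t. of_real (\<phi> t) * g t \<partial>circ) = (\<integral>t. of_real (\<phi> t) * g t - of_real (p (cis t)) * g t \<partial>circ)"
      using \<phi>g pgi by simp
    also have "cmod \<dots> \<le> (\<integral>t. cmod (of_real (\<phi> t) * g t - of_real (p (cis t)) * g t) \<partial>circ)"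
      by (rule integral_norm_bound)
    also have "\<dots> \<le> (\<integral>t. e * cmod (g t) \<partial>circ)"
    proof (rule integral_mono_AE)
      show "AE t in circ. cmod (of_real (\<phi> t) * g t - of_real (p (cis t)) * g t) \<le> e * cmod (g t)"
        \<comment> \<open>The angle recovered from \<open>cis t\<close> lies in [-pi, pi), so the
          end point pi is discarded as a null set.\<close>
        using AE_circ_neq[of pi]
      proof (rule lebesgue_on_mono)
        fix t assume t: "t \<noteq> pi" "t \<in> {-pi..pi}"
        then have "\<bar>\<phi> t - p (cis t)\<bar> \<le> e" using p(2)[of "cis t"] \<psi>[of t] by auto
        then show "cmod (of_real (\<phi> t) * g t - of_real (p (cis t)) * g t) \<le> e * cmod (g t)"
          unfolding left_diff_distrib[symmetric] norm_mult of_real_diff[symmetric] norm_of_real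
          by (intro mult_right_mono) auto
      qed
    qed (use g_int \<phi>g pgi in auto)
    finally show ?thesis using g_int by simp
  qed
  have "cmod (\<integral>t. of_real (\<phi> t) * g t \<partial>circ) \<le> 0"
  proof (rule field_le_epsilon)
    fix e :: real assume "e > 0"
    define I where "I = (\<integral>t. cmod (g t) \<partial>circ)"
    have I: "I \<ge> 0" unfolding I_def by simp
    \<comment> \<open>The summand 1 guards against \<open>I = 0\<close>.\<close>
    have "e / (I + 1) > 0" using \<open>e > 0\<close> I by simp
    from *[OF this] have "cmod (\<integral>t. of_real (\<phi> t) * g t \<partial>circ) \<le> e / (I + 1) * I" unfolding I_def .
    also have "\<dots> \<le> e" using \<open>e > 0\<close> I by (simp add: field_simps)
    finally show "cmod (\<integral>t. of_real (\<phi> t) * g t \<partial>circ) \<le> 0 + e" by simp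
  qed
  then show ?thesis by simp
qed

text \<open>Measurability of \<open>sgn h\<close> provides continuous functions converging to it
  almost everywhere. Made admissible as test functions, they give by dominated convergence that the
  integral of \<open>sgn h * h\<close>, which is the L^1 norm of \<open>h\<close>, is 0.\<close>

lemma integral_continuous_eq_0_imp_AE_0:
  fixes h :: "real \<Rightarrow> real"
  assumes h: "integrable circ h"
    and 0: "\<And>\<phi>. continuous_on {-pi..pi} \<phi> \<Longrightarrow> \<phi> (-pi) = \<phi> pi \<Longrightarrow> (\<integral>t. \<phi> t * h t \<partial>circ) = 0"
  shows "AE t in circ. h t = 0"
proof -
  have hm: "h \<in> borel_measurable circ" using h by auto
  then have "(\<lambda>t. sgn (h t)) measurable_on {-pi..pi}"
    by (subst measurable_on_iff_borel_measurable) auto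
  then obtain N f where N: "negligible N" and cf: "\<And>n. continuous_on UNIV (f n)"
    and lim: "\<And>x. x \<notin> N \<Longrightarrow> (\<lambda>n. f n x) \<longlonglongrightarrow> (if x \<in> {-pi..pi} then sgn (h x) else 0)"
    unfolding measurable_on_def by blast
  \<comment> \<open>The clipping to [-1, 1] yields the dominating function
    \<open>\<bar>h\<bar>\<close>. The second factor vanishes at both ends, which makes
    \<open>\<phi> n\<close> periodic, and it is eventually 1 at each interior point.\<close>
  define \<phi> where "\<phi> n t = max (-1) (min 1 (f n t)) * min 1 (real n * (pi - \<bar>t\<bar>))" for n t
  have c\<phi>: "continuous_on {-pi..pi} (\<phi> n)" for n
    unfolding \<phi>_def by (intro continuous_intros continuous_on_subset[OF cf]) auto
  have \<phi>_meas: "\<phi> n \<in> borel_measurable circ" for n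
    by (rule continuous_imp_measurable_on_sets_lebesgue[OF c\<phi>]) auto
  have \<phi>_le: "\<bar>\<phi> n t\<bar> \<le> 1" if "t \<in> {-pi..pi}" for n t
  proof -
    have "0 \<le> real n * (pi - \<bar>t\<bar>)" using that by (intro mult_nonneg_nonneg) auto
    then show ?thesis unfolding \<phi>_def abs_mult by (intro mult_le_one) auto
  qed
  have "(\<lambda>n. \<integral>t. \<phi> n t * h t \<partial>circ) \<longlonglongrightarrow> (\<integral>t. sgn (h t) * h t \<partial>circ)"
  proof (rule integral_dominated_convergence[where w = "\<lambda>t. \<bar>h t\<bar>"])
    show "AE t in circ. \<bar>h t\<bar> \<ge> norm (\<phi> n t * h t)" for n
      using \<phi>_le by (intro AE_I2) (auto simp: abs_mult intro!: mult_left_le_one_le)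
    have "AE t in lebesgue. t \<notin> N"
      using N by (auto simp: negligible_iff_null_sets intro: AE_not_in)
    then have "AE t in circ. t \<notin> N \<and> t \<noteq> pi \<and> t \<noteq> -pi"
      using AE_circ_neq[of pi] AE_circ_neq[of "-pi"] by (auto simp: AE_restrict_space_iff)
    then show "AE t in circ. (\<lambda>n. \<phi> n t * h t) \<longlonglongrightarrow> sgn (h t) * h t"
    proof (rule lebesgue_on_mono)
      fix t assume t: "t \<notin> N \<and> t \<noteq> pi \<and> t \<noteq> -pi" "t \<in> {-pi..pi}"
      then have pos: "pi - \<bar>t\<bar> > 0" by auto
      have "(\<lambda>n. max (-1) (min 1 (f n t))) \<longlonglongrightarrow> max (-1) (min 1 (sgn (h t)))"
        using lim[of t] t by (intro tendsto_intros) auto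
      also have "max (-1) (min 1 (sgn (h t))) = sgn (h t)" by (auto simp: sgn_if)
      finally have 1: "(\<lambda>n. max (-1) (min 1 (f n t))) \<longlonglongrightarrow> sgn (h t)" .
      have "\<forall>\<^sub>F n in sequentially. real n * (pi - \<bar>t\<bar>) \<ge> 1"
        using eventually_ge_at_top[of "nat \<lceil>1 / (pi - \<bar>t\<bar>)\<rceil>"]
      proof eventually_elim
        case (elim n)
        then have "1 / (pi - \<bar>t\<bar>) \<le> real n" by linarith
        then show ?case using pos by (simp add: field_simps)
      qed
      then have "(\<lambda>n. min 1 (real n * (pi - \<bar>t\<bar>))) \<longlonglongrightarrow> 1"
        by (intro tendsto_eventually) (auto elim!: eventually_mono)
      from tendsto_mult[OF 1 this] show "(\<lambda>n. \<phi> n t * h t) \<longlonglongrightarrow> sgn (h t) * h t"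
        unfolding \<phi>_def by (intro tendsto_mult_right) simp
    qed
  qed (use h hm \<phi>_meas in auto)
  moreover have "(\<integral>t. \<phi> n t * h t \<partial>circ) = 0" for n
    by (rule 0[OF c\<phi>]) (simp add: \<phi>_def)
  ultimately have "(\<integral>t. sgn (h t) * h t \<partial>circ) = 0"
    by (simp add: LIMSEQ_const_iff)
  then have "(\<integral>t. \<bar>h t\<bar> \<partial>circ) = 0"
    by (simp add: mult.commute abs_sgn[symmetric])
  then show ?thesis
    using h by (subst (asm) integral_nonneg_eq_0_iff_AE) auto
qed

lemma fcoef_null_imp_AE_0:
  assumes g: "fcoef_null g"
  shows "AE t in circ. g t = 0"
proof -
  have gi: "integrable circ g" using g by (simp add: fcoef_null_def)
  have *: "integrable circ (\<lambda>t. of_real (\<phi> t) * g t) \<and> (\<integral>t. of_real (\<phi> t) * g t \<partial>circ) = 0"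
    if c: "continuous_on {-pi..pi} \<phi>" "\<phi> (-pi) = \<phi> pi" for \<phi> :: "real \<Rightarrow> real"
    using integrable_mult_continuous[OF gi c(1)] fcoef_null_imp_integral_continuous_eq_0[OF g c] ..
  have "AE t in circ. Re (g t) = 0"
  proof (rule integral_continuous_eq_0_imp_AE_0)
    fix \<phi> :: "real \<Rightarrow> real" assume c: "continuous_on {-pi..pi} \<phi>" "\<phi> (-pi) = \<phi> pi"
    show "(\<integral>t. \<phi> t * Re (g t) \<partial>circ) = 0"
      using *[OF c] integral_Re[of circ "\<lambda>t. of_real (\<phi> t) * g t"] by simp
  qed (use gi in simp)
  moreover have "AE t in circ. Im (g t) = 0"
  proof (rule integral_continuous_eq_0_imp_AE_0)
    fix \<phi> :: "real \<Rightarrow> real" assume c: "continuous_on {-pi..pi} \<phi>" "\<phi> (-pi) = \<phi> pi"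
    show "(\<integral>t. \<phi> t * Im (g t) \<partial>circ) = 0"
      using *[OF c] integral_Im[of circ "\<lambda>t. of_real (\<phi> t) * g t"] by simp
  qed (use gi in simp)
  ultimately show ?thesis by eventually_elim (simp add: complex_eq_iff)
qed

section \<open>Riesz--Fischer and Parseval\<close>

lemma L2_uniqueness:
  assumes "sq_int g" "sq_int h" "\<And>m. fcoef g m = fcoef h m"
  shows "AE t in circ. g t = h t"
proof -
  have "fcoef_null (\<lambda>t. g t - h t)"
    using assms sq_int_integrable[OF assms(1)] sq_int_integrable[OF assms(2)]
    by (auto simp: fcoef_null_def fcoef_diff)
  from fcoef_null_imp_AE_0[OF this] show ?thesis by simp
qed

lemma infsum_ennreal_eq_SUP:
  fixes f :: "'a \<Rightarrow> ennreal"
  shows "infsum f A = (SUP F\<in>{F. finite F \<and> F \<subseteq> A}. sum f F)"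
  by (rule nonneg_infsum_complete) auto

text \<open>Summing a Fourier series along blocks of square sum at most \<open>4\<^sup>-\<^sup>k\<close> makes it converge
  absolutely almost everywhere.\<close>

lemma sq_summable_blocks:
  fixes a :: "int \<Rightarrow> complex"
  assumes bound: "\<And>F. finite F \<Longrightarrow> (\<Sum>m\<in>F. (cmod (a m))\<^sup>2) \<le> S"
  obtains D :: "nat \<Rightarrow> int set" where
    "\<And>k. finite (D k)" "disjoint_family D" "(\<Union>k. D k) = UNIV"
    "\<And>k. (\<Sum>m\<in>D (Suc k). (cmod (a m))\<^sup>2) \<le> (1/4) ^ k"
proof -
  define s where "s F = (\<Sum>m\<in>F. (cmod (a m))\<^sup>2)" for F
  define T where "T = (SUP F\<in>{F. finite F}. s F)"
  have bdd: "bdd_above (s ` {F. finite F})" using bound by (intro bdd_aboveI2[where M = S]) (auto simp: s_def)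
  have s_le: "s F \<le> T" if "finite F" for F
    unfolding T_def using that bdd by (intro cSUP_upper) auto
  have "\<exists>F. finite F \<and> T - (1/4) ^ k < s F" for k :: nat
  proof (rule ccontr)
    assume "\<not> ?thesis"
    then have "T \<le> T - (1/4) ^ k" unfolding T_def
      by (intro cSUP_least) (auto simp: not_less intro: finite.emptyI)
    moreover have "(1/4 :: real) ^ k > 0" by simp
    ultimately show False by linarith
  qed
  then obtain G where G: "\<And>k. finite (G k)" "\<And>k::nat. T - (1/4) ^ k < s (G k)" by metis
  \<comment> \<open>The sets \<open>G j\<close> alone may miss indices, for instance where
    \<open>a\<close> vanishes; the intervals ensure that every integer is covered, and the union
    over \<open>j \<le> k\<close> makes \<open>E\<close> increasing.\<close>
  define E where "E k = (\<Union>j\<le>k. G j) \<union> {- int k..int k}" for k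
  have finE: "finite (E k)" for k unfolding E_def using G(1) by auto
  have "T - (1/4) ^ k < s (E k)" for k
    using G(2)[of k] sum_mono2[OF finE, of "G k" k "\<lambda>m. (cmod (a m))\<^sup>2"] by (force simp: s_def E_def)
  then have tail: "s (E (Suc k) - E k) \<le> (1/4) ^ k" for k
  proof -
    have "s (E (Suc k)) = s (E (Suc k) - E k) + s (E k)"
      unfolding s_def by (intro sum.subset_diff finE) (force simp: E_def)
    then show ?thesis using s_le[OF finE, of "Suc k"] \<open>T - (1/4) ^ k < s (E k)\<close> by linarith
  qed
  have mono: "E j \<subseteq> E k" if "j \<le> k" for j k
    using that unfolding E_def by fastforce
  show thesis
  proof
    show "finite (disjointed E k)" for k using finE disjointed_subset[of E k] by (rule finite_subset[rotated])
    show "disjoint_family (disjointed E)" by (rule disjoint_family_disjointed)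
    have "x \<in> (\<Union>k. E k)" for x :: int
      by (rule UN_I[of "nat \<bar>x\<bar>"]) (auto simp: E_def)
    then show "(\<Union>k. disjointed E k) = UNIV" unfolding UN_disjointed_eq by blast
    have "disjointed E (Suc k) = E (Suc k) - E k" for k
      using disjointed_mono[of E k] mono by (auto simp: mono_def)
    with tail show "(\<Sum>m\<in>disjointed E (Suc k). (cmod (a m))\<^sup>2) \<le> (1/4) ^ k" for k
      by (simp add: s_def)
  qed
qed

text \<open>The L^1 norms of the blocks decay geometrically, so their series converges absolutely
  almost everywhere. Fatou's lemma bounds the norm of the limit, and integrating term by term gives
  the coefficients, as each index lies in exactly one block.\<close>

theorem Riesz_Fischer:
  fixes a :: "int \<Rightarrow> complex"
  assumes bound: "\<And>F. finite F \<Longrightarrow> (\<Sum>m\<in>F. (cmod (a m))\<^sup>2) \<le> S"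
  obtains g where "sq_int g" "\<And>m. fcoef g m = a m"
    "(\<integral>\<^sup>+t. ennreal ((cmod (g t))\<^sup>2) \<partial>circ) \<le> ennreal S"
proof -
  obtain D :: "nat \<Rightarrow> int set" where finD: "\<And>k. finite (D k)" and disj: "disjoint_family D"
    and UN: "(\<Union>k. D k) = UNIV" and small: "\<And>k. (\<Sum>m\<in>D (Suc k). (cmod (a m))\<^sup>2) \<le> (1/4) ^ k"
    using sq_summable_blocks[OF bound] by metis
  define d where "d k = trig_sum a (D k)" for k
  have sq: "sq_int (d k)" for k unfolding d_def by (rule sq_int_trig_sum)
  have meas[measurable]: "d k \<in> borel_measurable circ" for k using sq by (simp add: sq_int_def)
  have di: "integrable circ (d k)" for k by (rule sq_int_integrable[OF sq])
  have L1: "(\<integral>t. cmod (d (Suc k) t) \<partial>circ) \<le> (2 * pi + 1) * (1/2) ^ k" for k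
  proof -
    define q :: real where "q = (1/2) ^ k"
    have q: "q > 0" "q * q = (1/4) ^ k" by (auto simp: q_def power_mult_distrib[symmetric])
    \<comment> \<open>A weighted AM-GM inequality in the role of Cauchy-Schwarz. The choice
      \<open>q = (1/2) ^ k\<close> balances the terms, since the squared L^2 norm of the block is at
      most \<open>q * q\<close>.\<close>
    have "cmod z \<le> q + (cmod z)\<^sup>2 / q" for z
    proof -
      have "q * cmod z \<le> q * q + (cmod z)\<^sup>2"
        using sum_squares_bound[of q "cmod z"] mult_nonneg_nonneg[OF less_imp_le[OF q(1)] norm_ge_zero[of z]]
        by (simp only: power2_eq_square mult.assoc)
      then show ?thesis using q(1) by (simp add: field_simps)
    qed
    then have "(\<integral>t. cmod (d (Suc k) t) \<partial>circ) \<le> (\<integral>t. q + (cmod (d (Suc k) t))\<^sup>2 / q \<partial>circ)"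
      using di sq by (intro integral_mono) (auto simp: sq_int_def)
    also have "\<dots> = 2 * pi * q + (\<Sum>m\<in>D (Suc k). (cmod (a m))\<^sup>2) / q"
      using sq emeasure_circ unfolding d_def
      by (simp add: sq_int_def integral_trig_sum_sq[OF finD] measure_def)
    also have "\<dots> \<le> 2 * pi * q + (q * q) / q"
      using small[of k] q by (intro add_left_mono divide_right_mono) auto
    finally show ?thesis using q(1) by (simp add: q_def ring_distribs)
  qed
  have sumL1: "summable (\<lambda>k. \<integral>t. cmod (d k t) \<partial>circ)"
  \<comment> \<open>The decay is known only from block 1 on; block 0 may be large.\<close>
  proof (subst summable_Suc_iff[symmetric], rule summable_comparison_test')
    show "summable (\<lambda>k. (2 * pi + 1) * (1/2) ^ k)" by (intro summable_mult summable_geometric) auto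
    show "norm (\<integral>t. cmod (d (Suc k) t) \<partial>circ) \<le> (2 * pi + 1) * (1/2) ^ k" for k using L1[of k] by simp
  qed
  have AEs: "AE t in circ. summable (\<lambda>k. cmod (d k t))"
  proof -
    have "(\<integral>\<^sup>+t. (\<Sum>k. ennreal (cmod (d k t))) \<partial>circ) = (\<Sum>k. \<integral>\<^sup>+t. ennreal (cmod (d k t)) \<partial>circ)"
      by (rule nn_integral_suminf) measurable
    also have "\<dots> = (\<Sum>k. ennreal (\<integral>t. cmod (d k t) \<partial>circ))"
      using di by (intro suminf_cong nn_integral_eq_integral) auto
    also have "\<dots> \<noteq> \<infinity>" using sumL1 by (simp add: ennreal_suminf_neq_top)
    finally have "AE t in circ. (\<Sum>k. ennreal (cmod (d k t))) \<noteq> \<infinity>"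
      by (intro nn_integral_PInf_AE) auto
    then show ?thesis by eventually_elim (rule summable_suminf_not_top, auto)
  qed
  define g where "g t = (\<Sum>k. d k t)" for t
  have gm: "g \<in> borel_measurable circ" unfolding g_def by measurable
  have disj': "sum f (\<Union>k<n. D k) = (\<Sum>k<n. sum f (D k))" for f :: "int \<Rightarrow> 'b::comm_monoid_add" and n
    using disj finD by (intro sum.UNION_disjoint) (auto simp: disjoint_family_on_def)
  have partial_sum: "(\<Sum>k<n. d k t) = trig_sum a (\<Union>k<n. D k) t" for n t
  proof -
    let ?e = "\<lambda>m. a m * cis (- of_int m * t)"
    have "(\<Sum>k<n. d k t) = of_real (1 / sqrt (2 * pi)) * (\<Sum>k<n. sum ?e (D k))"
      unfolding d_def trig_sum_def by (rule sum_distrib_left[symmetric])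
    also have "(\<Sum>k<n. sum ?e (D k)) = sum ?e (\<Union>k<n. D k)" by (rule disj'[symmetric])
    finally show ?thesis by (simp only: trig_sum_def)
  qed
  have fatou: "(\<integral>\<^sup>+t. ennreal ((cmod (g t))\<^sup>2) \<partial>circ) \<le> ennreal S"
  proof -
    have "AE t in circ. ennreal ((cmod (g t))\<^sup>2) \<le> liminf (\<lambda>n. ennreal ((cmod (\<Sum>k<n. d k t))\<^sup>2))"
      using AEs
    proof eventually_elim
      case (elim t)
      then have "(\<lambda>n. \<Sum>k<n. d k t) \<longlonglongrightarrow> g t"
        unfolding g_def by (rule summable_LIMSEQ[OF summable_norm_cancel])
      then have "(\<lambda>n. ennreal ((cmod (\<Sum>k<n. d k t))\<^sup>2)) \<longlonglongrightarrow> ennreal ((cmod (g t))\<^sup>2)"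
        by (intro tendsto_ennrealI tendsto_power tendsto_norm)
      from lim_imp_Liminf[OF _ this] show ?case by simp
    qed
    then have "(\<integral>\<^sup>+t. ennreal ((cmod (g t))\<^sup>2) \<partial>circ) \<le>
        (\<integral>\<^sup>+t. liminf (\<lambda>n. ennreal ((cmod (\<Sum>k<n. d k t))\<^sup>2)) \<partial>circ)"
      by (rule nn_integral_mono_AE)
    also have "\<dots> \<le> liminf (\<lambda>n. \<integral>\<^sup>+t. ennreal ((cmod (\<Sum>k<n. d k t))\<^sup>2) \<partial>circ)"
      by (rule nn_integral_liminf) measurable
    also have "\<dots> \<le> liminf (\<lambda>n. ennreal S)"
    proof (rule Liminf_mono, rule always_eventually, rule allI)
      fix n
      have fin: "finite (\<Union>k<n. D k)" using finD by auto
      have "(\<integral>\<^sup>+t. ennreal ((cmod (\<Sum>k<n. d k t))\<^sup>2) \<partial>circ) = ennreal (\<Sum>m\<in>(\<Union>k<n. D k). (cmod (a m))\<^sup>2)"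
        unfolding partial_sum integral_trig_sum_sq[OF fin, symmetric]
        using sq_int_trig_sum by (intro nn_integral_eq_integral) (auto simp: sq_int_def)
      also have "\<dots> \<le> ennreal S" using bound[OF fin] by (rule ennreal_leI)
      finally show "(\<integral>\<^sup>+t. ennreal ((cmod (\<Sum>k<n. d k t))\<^sup>2) \<partial>circ) \<le> ennreal S" .
    qed
    finally show ?thesis by (simp add: Liminf_const)
  qed
  have "sq_int g" using fatou gm by (auto simp: sq_int_iff_nn intro: le_less_trans)
  moreover have "fcoef g m = a m" for m
  proof -
    obtain k0 where k0: "m \<in> D k0" using UN by blast
    have k0': "m \<in> D k \<longleftrightarrow> k = k0" for k
      using k0 disj by (auto simp: disjoint_family_on_def)
    let ?e = "\<lambda>k t. d k t * cis (of_int m * t)"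
    have "(\<integral>t. (\<Sum>k. ?e k t) \<partial>circ) = (\<Sum>k. (\<integral>t. ?e k t \<partial>circ))"
      using AEs sumL1 integrable_mult_cis[OF di] by (intro integral_suminf) (auto simp: norm_mult)
    moreover have "(\<integral>t. (\<Sum>k. ?e k t) \<partial>circ) = (\<integral>t. g t * cis (of_int m * t) \<partial>circ)"
    proof (rule integral_cong_AE)
      show "AE t in circ. (\<Sum>k. ?e k t) = g t * cis (of_int m * t)"
        using AEs unfolding g_def by eventually_elim (rule suminf_mult2[symmetric], rule summable_norm_cancel)
    qed (use gm in measurable)
    moreover have "(\<integral>t. ?e k t \<partial>circ) = sqrt (2 * pi) * fcoef (d k) m" for k
      by (simp add: fcoef_def)
    moreover have "fcoef (d k) m = (if k = k0 then a m else 0)" for k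
      unfolding d_def fcoef_trig_sum[OF finD] k0' ..
    ultimately have "(\<integral>t. g t * cis (of_int m * t) \<partial>circ) = (\<Sum>k. sqrt (2 * pi) * (if k = k0 then a m else 0))"
      by simp
    also have "\<dots> = sqrt (2 * pi) * a m"
      by (subst suminf_finite[of "{k0}"]) auto
    finally show ?thesis by (simp add: fcoef_def)
  qed
  ultimately show thesis using fatou that by blast
qed

text \<open>One inequality is Bessel's. For the other, Riesz-Fischer rebuilds from the coefficients
  a function \<open>h\<close> whose squared norm is at most their square sum, and uniqueness
  identifies \<open>h\<close> with \<open>g\<close>.\<close>

theorem Parseval:
  assumes g: "sq_int g"
  shows "(\<Sum>\<^sub>\<infinity>m. ennreal ((cmod (fcoef g m))\<^sup>2)) = (\<integral>\<^sup>+t. ennreal ((cmod (g t))\<^sup>2) \<partial>circ)"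
proof (rule antisym)
  define S where "S = (\<Sum>\<^sub>\<infinity>m. ennreal ((cmod (fcoef g m))\<^sup>2))"
  have int: "(\<integral>\<^sup>+t. ennreal ((cmod (g t))\<^sup>2) \<partial>circ) = ennreal (\<integral>t. (cmod (g t))\<^sup>2 \<partial>circ)"
    using g by (intro nn_integral_eq_integral) (auto simp: sq_int_def)
  show le: "(\<Sum>\<^sub>\<infinity>m. ennreal ((cmod (fcoef g m))\<^sup>2)) \<le> (\<integral>\<^sup>+t. ennreal ((cmod (g t))\<^sup>2) \<partial>circ)"
    unfolding infsum_ennreal_eq_SUP int
    by (rule SUP_least) (auto simp: sum_ennreal intro!: ennreal_leI Bessel_inequality[OF g])
  have "S < \<infinity>" using le unfolding S_def int by (auto intro: le_less_trans)
  then obtain s where s: "S = ennreal s" "s \<ge> 0" by (cases S) auto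
  have "(\<Sum>m\<in>F. (cmod (fcoef g m))\<^sup>2) \<le> s" if "finite F" for F
  proof -
    have "ennreal (\<Sum>m\<in>F. (cmod (fcoef g m))\<^sup>2) = (\<Sum>m\<in>F. ennreal ((cmod (fcoef g m))\<^sup>2))"
      by (simp add: sum_ennreal)
    also have "\<dots> \<le> S" unfolding S_def infsum_ennreal_eq_SUP using that by (intro SUP_upper) auto
    finally show ?thesis using s by simp
  qed
  from Riesz_Fischer[OF this] obtain h where h: "sq_int h" "\<And>m. fcoef h m = fcoef g m"
    "(\<integral>\<^sup>+t. ennreal ((cmod (h t))\<^sup>2) \<partial>circ) \<le> ennreal s" by metis
  have "AE t in circ. h t = g t" by (rule L2_uniqueness[OF h(1) g h(2)])
  then have "(\<integral>\<^sup>+t. ennreal ((cmod (g t))\<^sup>2) \<partial>circ) = (\<integral>\<^sup>+t. ennreal ((cmod (h t))\<^sup>2) \<partial>circ)"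
    by (intro nn_integral_cong_AE) auto
  also have "\<dots> \<le> S" using h(3) s by simp
  finally show "(\<integral>\<^sup>+t. ennreal ((cmod (g t))\<^sup>2) \<partial>circ) \<le> (\<Sum>\<^sub>\<infinity>m. ennreal ((cmod (fcoef g m))\<^sup>2))"
    unfolding S_def .
qed

section \<open>Asymptotics of the Bergman kernel\<close>

definition mult_q :: "real \<Rightarrow> real" where
  "mult_q t = cos t / (1 + sin t)"

text \<open>From \<open>cos^2 = (1 - sin) (1 + sin)\<close> follows
  \<open>q^2 = (1 - sin t) / (1 + sin t)\<close>. Where \<open>sin t = -1\<close>, division by zero
  gives \<open>q = 0\<close> and the identity fails.\<close>

lemma one_minus_mult_q_sq:
  assumes "sin t \<noteq> -1"
  shows "1 - (mult_q t)\<^sup>2 = 2 * sin t / (1 + sin t)"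
proof -
  have s: "1 + sin t \<noteq> 0" using assms by linarith
  have "(mult_q t)\<^sup>2 * (1 + sin t)\<^sup>2 = (cos t)\<^sup>2"
    using s by (simp add: mult_q_def power_divide)
  also have "\<dots> = (1 - sin t) * (1 + sin t)"
    by (simp add: cos_squared_eq power2_eq_square algebra_simps)
  finally have "(mult_q t)\<^sup>2 * (1 + sin t) = 1 - sin t"
    using s by (simp add: power2_eq_square)
  then show ?thesis using s by (simp add: field_simps)
qed

lemma sin_Icc_nonneg: "t \<in> {0..pi} \<Longrightarrow> 0 \<le> sin t"
  by (auto intro: sin_ge_zero)

lemma one_plus_sin_neq_0: "t \<in> {0..pi} \<Longrightarrow> 1 + sin t \<noteq> 0"
  using sin_Icc_nonneg[of t] by linarith

text \<open>Since \<open>q' = -1 / (1 + sin t)\<close> and \<open>q\<close> runs from 1 to -1, this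
  is the substitution \<open>s = q(t)\<close> in the integral of \<open>s^(2n) (1 - s^2)\<close>
  over [-1, 1].\<close>

lemma mult_q_FTC:
  "(LBINT t:{0..pi}. mult_q t ^ (2 * n) * (1 - (mult_q t)\<^sup>2) / (1 + sin t)) =
     4 / ((2 * real n + 1) * (2 * real n + 3))"
proof -
  let ?F = "\<lambda>t. mult_q t ^ (2 * n + 3) / (2 * real n + 3) - mult_q t ^ (2 * n + 1) / (2 * real n + 1)"
  have "(\<integral>t. indicator {0..pi} t *\<^sub>R (mult_q t ^ (2 * n) * (1 - (mult_q t)\<^sup>2) / (1 + sin t)) \<partial>lborel) = ?F pi - ?F 0"
  proof (rule integral_FTC_Icc)
    fix t :: real assume t: "0 \<le> t" "t \<le> pi"
    then have s: "1 + sin t \<noteq> 0" using sin_Icc_nonneg[of t] by auto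
    have "(mult_q has_real_derivative - (sin t * (1 + sin t) + cos t * cos t) / ((1 + sin t) * (1 + sin t))) (at t within {0..pi})"
      unfolding mult_q_def by (rule derivative_eq_intros refl s | simp)+
    moreover have "- (sin t * (1 + sin t) + cos t * cos t) / ((1 + sin t) * (1 + sin t)) = - (1 / (1 + sin t))"
      using s sin_cos_squared_add3[of t] by (simp add: divide_simps) (simp add: algebra_simps)
    ultimately have q: "(mult_q has_real_derivative - (1 / (1 + sin t))) (at t within {0..pi})" by simp
    have pow: "((\<lambda>t. mult_q t ^ Suc k / real (Suc k)) has_real_derivative - (mult_q t ^ k / (1 + sin t))) (at t within {0..pi})" for k
    proof -
      have "(1 + real k) * (- (1 / (1 + sin t)) * mult_q t ^ k) / real (Suc k) = - (mult_q t ^ k / (1 + sin t))"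
        by (simp add: add.commute)
      with DERIV_cdivide[OF DERIV_power_Suc[OF q, of k], of "real (Suc k)"] show ?thesis by simp
    qed
    have "(?F has_real_derivative - (mult_q t ^ (2 * n + 2) / (1 + sin t)) - - (mult_q t ^ (2 * n) / (1 + sin t))) (at t within {0..pi})"
      using DERIV_diff[OF pow[of "2 * n + 2"] pow[of "2 * n"]] by (simp add: numeral_3_eq_3 add.commute)
    also have "- (mult_q t ^ (2 * n + 2) / (1 + sin t)) - - (mult_q t ^ (2 * n) / (1 + sin t)) = mult_q t ^ (2 * n) * (1 - (mult_q t)\<^sup>2) / (1 + sin t)"
      by (simp add: power_add power2_eq_square algebra_simps diff_divide_distrib)
    finally show "(?F has_vector_derivative mult_q t ^ (2 * n) * (1 - (mult_q t)\<^sup>2) / (1 + sin t)) (at t within {0..pi})"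
      by (simp add: has_real_derivative_iff_has_vector_derivative)
  next
    show "continuous_on {0..pi} (\<lambda>t. mult_q t ^ (2 * n) * (1 - (mult_q t)\<^sup>2) / (1 + sin t))"
      unfolding mult_q_def by (intro continuous_intros ballI one_plus_sin_neq_0)
  qed simp
  also have "\<dots> = 2 / (2 * real n + 1) - 2 / (2 * real n + 3)"
    by (simp add: mult_q_def power_add power_mult)
  also have "\<dots> = 4 / ((2 * real n + 1) * (2 * real n + 3))"
    by (simp add: divide_simps) 
  finally show ?thesis by (simp add: set_lebesgue_integral_def)
qed

text \<open>The kernel is \<open>J / (2 pi)\<close>. The factor \<open>1 + sin t\<close> lies in
  [1, 2], so \<open>J\<close> lies between the explicit integral \<open>K\<close> and
  \<open>2 K\<close>; the upper bound 1 is \<open>8/3 \<le> 2 pi\<close>.\<close>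

lemma bergman_diag_bounds:
  "1 / (2 * pi) \<le> bergman_diag (m, n) * (real n + 1)\<^sup>2" "bergman_diag (m, n) * (real n + 1)\<^sup>2 \<le> 1"
proof -
  let ?f = "\<lambda>t. mult_q t ^ (2 * n) * (1 - (mult_q t)\<^sup>2)"
  define J where "J = (LBINT t:{0..pi}. ?f t)"
  define K where "K = (LBINT t:{0..pi}. ?f t / (1 + sin t))"
  have q: "0 \<le> ?f t" if "t \<in> {0..pi}" for t
    using one_minus_mult_q_sq[of t] sin_Icc_nonneg[OF that] by simp
  have cont: "continuous_on {0..pi} mult_q"
    unfolding mult_q_def by (intro continuous_intros ballI one_plus_sin_neq_0)
  have int1: "set_integrable lborel {0..pi} ?f"
    by (intro borel_integrable_atLeastAtMost' continuous_intros cont)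
  have int2: "set_integrable lborel {0..pi} (\<lambda>t. ?f t / (1 + sin t))"
    by (intro borel_integrable_atLeastAtMost' continuous_intros cont ballI one_plus_sin_neq_0)
  have B: "bergman_diag (m, n) = 1 / (2 * pi) * J"
    unfolding bergman_diag_def J_def prod.case
  proof (intro arg_cong[where f = "(*) _"] set_lebesgue_integral_cong allI impI)
    fix t assume "t \<in> {0..pi}"
    then have "sin t \<noteq> -1" using sin_Icc_nonneg[of t] by auto
    then show "(cos t / (1 + sin t)) ^ (2 * n) * (2 * sin t / (1 + sin t)) = ?f t"
      unfolding one_minus_mult_q_sq[OF \<open>sin t \<noteq> -1\<close>] by (simp add: mult_q_def)
  qed simp
  have "K \<le> J" unfolding K_def J_def
  proof (rule set_integral_mono[OF int2 int1])
    fix t assume t: "t \<in> {0..pi}"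
    have "?f t * 1 \<le> ?f t * (1 + sin t)" by (rule mult_left_mono[OF _ q[OF t]]) (use sin_Icc_nonneg[OF t] in simp)
    then show "?f t / (1 + sin t) \<le> ?f t"
      using sin_Icc_nonneg[OF t] by (subst pos_divide_le_eq) auto
  qed
  have "J \<le> (LBINT t:{0..pi}. 2 * (?f t / (1 + sin t)))" unfolding J_def
  proof (rule set_integral_mono[OF int1])
    fix t assume t: "t \<in> {0..pi}"
    have "?f t * (1 + sin t) \<le> ?f t * 2" by (rule mult_left_mono[OF _ q[OF t]]) simp
    then show "?f t \<le> 2 * (?f t / (1 + sin t))"
      using sin_Icc_nonneg[OF t] by (simp add: pos_le_divide_eq mult.commute)
  qed (rule set_integrable_mult_right[OF int2])
  also have "\<dots> = 2 * K" unfolding K_def by (rule set_integral_mult_right)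
  finally have "J \<le> 2 * K" .
  have K: "K = 4 / ((2 * real n + 1) * (2 * real n + 3))" unfolding K_def by (rule mult_q_FTC)
  define x where "x = real n"
  have x: "x \<ge> 0" by (simp add: x_def)
  define D where "D = (2 * x + 1) * (2 * x + 3)"
  have "D > 0" unfolding D_def using x by (intro mult_pos_pos) auto
  have KD: "K * (x + 1)\<^sup>2 = 4 * (x + 1)\<^sup>2 / D" unfolding K D_def x_def by simp
  have D: "D = 4 * (x + 1)\<^sup>2 - 1" by (simp add: D_def power2_eq_square algebra_simps)
  have "1\<^sup>2 \<le> (x + 1)\<^sup>2" using x by (intro power_mono) auto
  have "1 \<le> K * (x + 1)\<^sup>2" unfolding KD pos_le_divide_eq[OF \<open>D > 0\<close>] using D by simp
  \<comment> \<open>With y = (x + 1)^2 the quotient is 4 y / (4 y - 1), which is largest at y = 1,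
    that is for \<open>n = 0\<close>.\<close>
  moreover have "K * (x + 1)\<^sup>2 \<le> 4 / 3"
    unfolding KD pos_divide_le_eq[OF \<open>D > 0\<close>] using D \<open>1\<^sup>2 \<le> (x + 1)\<^sup>2\<close> by simp
  moreover have "K * (x + 1)\<^sup>2 \<le> J * (x + 1)\<^sup>2" "J * (x + 1)\<^sup>2 \<le> 2 * (K * (x + 1)\<^sup>2)"
    using mult_right_mono[OF \<open>K \<le> J\<close>, of "(x + 1)\<^sup>2"] mult_right_mono[OF \<open>J \<le> 2 * K\<close>, of "(x + 1)\<^sup>2"] by auto
  ultimately have J: "1 \<le> J * (x + 1)\<^sup>2" "J * (x + 1)\<^sup>2 \<le> 8 / 3" by linarith+
  have "1 * inverse (2 * pi) \<le> (J * (x + 1)\<^sup>2) * inverse (2 * pi)"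
    by (rule mult_right_mono[OF J(1)]) simp
  then show "1 / (2 * pi) \<le> bergman_diag (m, n) * (real n + 1)\<^sup>2"
    unfolding B x_def by (simp add: field_simps)
  have "J * (x + 1)\<^sup>2 \<le> 2 * pi" using J(2) pi_gt3 by linarith
  then show "bergman_diag (m, n) * (real n + 1)\<^sup>2 \<le> 1"
    unfolding B x_def by (simp add: field_simps)
qed

lemma bergman_diag_pos: "bergman_diag (m, n) > 0"
proof -
  have "0 < bergman_diag (m, n) * (real n + 1)\<^sup>2"
    using bergman_diag_bounds(1)[of m n] by (rule less_le_trans[rotated]) simp
  then show ?thesis by (simp add: zero_less_mult_iff)
qed

text \<open>The sign of \<open>\<nu>\<close> decides whether the power is increasing or decreasing
  on [1/(2 pi), 1]; \<open>min\<close> and \<open>max\<close> of the two end values serve both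
  cases.\<close>

lemma bergman_diag_powr_bounds:
  obtains c C where "c > 0" "C > 0"
    "\<And>m n. c * (real n + 1) powr (- 2 * \<nu>) \<le> bergman_diag (m, n) powr \<nu>"
    "\<And>m n. bergman_diag (m, n) powr \<nu> \<le> C * (real n + 1) powr (- 2 * \<nu>)"
proof
  define a where "a = (1 / (2 * pi)) powr \<nu>"
  have a: "a > 0" by (simp add: a_def)
  show "min 1 a > 0" "max 1 a > 0" using a by auto
  fix m n
  define \<theta> where "\<theta> = bergman_diag (m, n) * (real n + 1)\<^sup>2"
  have \<theta>: "1 / (2 * pi) \<le> \<theta>" "\<theta> \<le> 1" unfolding \<theta>_def by (rule bergman_diag_bounds)+
  have "\<theta> > 0" by (rule less_le_trans[OF _ \<theta>(1)]) simp
  have "bergman_diag (m, n) = \<theta> * (real n + 1) powr (-2)"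
    by (simp add: \<theta>_def powr_minus powr_numeral)
  then have eq: "bergman_diag (m, n) powr \<nu> = \<theta> powr \<nu> * (real n + 1) powr (- 2 * \<nu>)"
    using \<open>\<theta> > 0\<close> by (simp add: powr_mult powr_powr)
  have "min 1 a \<le> \<theta> powr \<nu> \<and> \<theta> powr \<nu> \<le> max 1 a"
  proof (cases "\<nu> \<ge> 0")
    case True
    then have "a \<le> \<theta> powr \<nu>" "\<theta> powr \<nu> \<le> 1 powr \<nu>"
      unfolding a_def using \<theta> \<open>\<theta> > 0\<close> by (intro powr_mono2; simp)+
    then show ?thesis by auto
  next
    case False
    then have "1 powr \<nu> \<le> \<theta> powr \<nu>" "\<theta> powr \<nu> \<le> a"
      unfolding a_def using \<theta> \<open>\<theta> > 0\<close> by (intro powr_mono2'; simp)+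
    then show ?thesis by auto
  qed
  then show "min 1 a * (real n + 1) powr (- 2 * \<nu>) \<le> bergman_diag (m, n) powr \<nu>"
    "bergman_diag (m, n) powr \<nu> \<le> max 1 a * (real n + 1) powr (- 2 * \<nu>)"
    unfolding eq by (auto intro: mult_right_mono)
qed

section \<open>Binomial coefficients and the size of the weight\<close>

lemma pos_LIMSEQ_bounds:
  fixes r :: "nat \<Rightarrow> real"
  assumes "r \<longlonglongrightarrow> l" "l > 0" "\<And>n. r n > 0"
  obtains c C where "c > 0" "C > 0" "\<And>n. c \<le> r n" "\<And>n. r n \<le> C"
proof -
  have "Bseq r" using assms(1) by (intro convergent_imp_Bseq convergentI)
  then obtain C where C: "C > 0" "\<And>n. norm (r n) \<le> C" by (auto simp: Bseq_def)
  have "Bseq (\<lambda>n. inverse (r n))"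
    using assms(1,2) by (intro convergent_imp_Bseq convergentI[OF tendsto_inverse]) auto
  then obtain c where c: "c > 0" "\<And>n. norm (inverse (r n)) \<le> c" by (auto simp: Bseq_def)
  show thesis
  proof
    show "inverse c > 0" "C > 0" using c C by auto
    show "inverse c \<le> r n" for n
      using c(2)[of n] assms(3)[of n] c(1) by (simp add: field_simps)
    show "r n \<le> C" for n using C(2)[of n] by simp
  qed
qed

text \<open>The ratio of the two sequences tends to \<open>Gamma \<mu> > 0\<close> and has positive
  terms, so it stays between positive constants.\<close>

lemma pochhammer_powr_bounds:
  fixes \<mu> :: real
  assumes \<mu>: "\<mu> > 0"
  obtains c C where "c > 0" "C > 0"
    "\<And>n. c * (pochhammer \<mu> n / fact n) \<le> (real n + 1) powr (\<mu> - 1)"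
    "\<And>n. (real n + 1) powr (\<mu> - 1) \<le> C * (pochhammer \<mu> n / fact n)"
proof -
  define r where "r n = (real n + 1) powr (\<mu> - 1) / (pochhammer \<mu> n / fact n)" for n
  have pos: "pochhammer \<mu> n > 0" for n using \<mu> by (rule pochhammer_pos)
  \<comment> \<open>Two factors tending to 1 adapt \<open>Gamma_series\<close>: the first turns
    \<open>n powr \<mu>\<close> into \<open>(n + 1) powr \<mu>\<close>, the second equals (\<mu> +
    n)/(n + 1), which cancels the surplus Pochhammer factor and lowers the exponent to
    \<open>\<mu> - 1\<close>.\<close>
  have 1: "(\<lambda>n. Gamma_series \<mu> n * ((real n / real (Suc n)) powr (- \<mu>) * (1 + (\<mu> - 1) * inverse (real (Suc n))))) \<longlonglongrightarrow> Gamma \<mu> * (1 powr (- \<mu>) * (1 + (\<mu> - 1) * 0))"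
    by (intro tendsto_intros Gamma_series_LIMSEQ LIMSEQ_n_over_Suc_n LIMSEQ_inverse_real_of_nat) auto
  have "r \<longlonglongrightarrow> Gamma \<mu>"
  proof (rule Lim_transform_eventually)
    show "(\<lambda>n. Gamma_series \<mu> n * ((real n / real (Suc n)) powr (- \<mu>) * (1 + (\<mu> - 1) * inverse (real (Suc n))))) \<longlonglongrightarrow> Gamma \<mu>"
      using 1 by simp
    show "\<forall>\<^sub>F n in sequentially. Gamma_series \<mu> n * ((real n / real (Suc n)) powr (- \<mu>) * (1 + (\<mu> - 1) * inverse (real (Suc n)))) = r n"
      using eventually_gt_at_top[of 0]
    proof eventually_elim
      case (elim n)
      define x where "x = real n"
      have x: "x > 0" using elim by (simp add: x_def)
      have "Gamma_series \<mu> n = fact n * x powr \<mu> / (pochhammer \<mu> n * (\<mu> + x))"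
        using x by (simp add: Gamma_series_def pochhammer_rec' powr_def x_def mult.commute)
      moreover have "(x / (x + 1)) powr (- \<mu>) = (x + 1) powr \<mu> / x powr \<mu>"
        using x by (simp add: powr_divide powr_minus inverse_eq_divide)
      moreover have "1 + (\<mu> - 1) * inverse (x + 1) = (\<mu> + x) / (x + 1)"
        using x by (simp add: divide_simps)
      moreover have "(x + 1) powr (\<mu> - 1) = (x + 1) powr \<mu> / (x + 1)"
        using x by (simp add: powr_diff)
      moreover have "real (Suc n) = x + 1" by (simp add: x_def)
      \<comment> \<open>The cancellation is stated for abstract quantities, so that rewriting cannot
        disturb the powers and the Pochhammer symbol.\<close>
      moreover have "F * Q / (P * y) * (R / Q * (y / z)) = R / z / (P / F)"
        if "F \<noteq> 0" "Q \<noteq> 0" "P \<noteq> 0" "y \<noteq> 0" "z \<noteq> 0" for F Q P y R z :: real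
        using that by (simp add: mult.commute)
      moreover have "x powr \<mu> \<noteq> 0" "\<mu> + x \<noteq> 0" "x + 1 \<noteq> 0" "pochhammer \<mu> n \<noteq> 0"
        using x \<mu> pos[of n] by auto
      ultimately show ?case
        unfolding r_def x_def[symmetric] by (simp only: fact_nonzero not_False_eq_True simp_thms)
    qed
  qed
  from pos_LIMSEQ_bounds[OF this] obtain c C where c: "c > 0" "C > 0" "\<And>n. c \<le> r n" "\<And>n. r n \<le> C"
    using Gamma_real_pos[OF \<mu>] pos by (auto simp: r_def)
  show thesis
  proof
    fix n
    have p: "pochhammer \<mu> n / fact n > 0" using pos by simp
    then show "c * (pochhammer \<mu> n / fact n) \<le> (real n + 1) powr (\<mu> - 1)"
      "(real n + 1) powr (\<mu> - 1) \<le> C * (pochhammer \<mu> n / fact n)"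
      using c(3,4)[of n] unfolding r_def by (simp_all only: pos_le_divide_eq[OF p] pos_divide_le_eq[OF p])
  qed (use c in auto)
qed

lemma pochhammer_binomial_sums:
  fixes \<mu> x :: real
  assumes "0 \<le> x" "x < 1"
  shows "(\<lambda>n. pochhammer \<mu> n / fact n * x ^ n) sums (1 - x) powr (- \<mu>)"
proof -
  have "(\<lambda>n. (- \<mu> gchoose n) * (- x) ^ n) sums (1 + - x) powr (- \<mu>)"
    by (rule gen_binomial_real) (use assms in auto)
  moreover have "(- \<mu> gchoose n) * (- x) ^ n = pochhammer \<mu> n / fact n * x ^ n" for n
    unfolding gbinomial_pochhammer power_minus[of x] by (simp add: power_mult_distrib[symmetric])
  ultimately show ?thesis by simp
qed

text \<open>For \<open>x < 1\<close> the coefficients are compared one by one with those of the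
  negative binomial series of \<open>(1 - x) powr (- \<mu>)\<close>. For \<open>x \<ge> 1\<close>
  the terms dominate a multiple of \<open>(n + 1) powr (\<mu> - 1)\<close>, whose sum diverges as
  the exponent exceeds -1.\<close>

lemma weight_sum_bounds:
  fixes \<mu> :: real
  assumes \<mu>: "\<mu> > 0"
  obtains c C where "c > 0" "C > 0"
    "\<And>x. 0 \<le> x \<Longrightarrow> x < 1 \<Longrightarrow> ennreal (c * (1 - x) powr (- \<mu>)) \<le> (\<Sum>n. ennreal (bergman_diag (0, n) powr ((1 - \<mu>) / 2) * x ^ n))"
    "\<And>x. 0 \<le> x \<Longrightarrow> x < 1 \<Longrightarrow> (\<Sum>n. ennreal (bergman_diag (0, n) powr ((1 - \<mu>) / 2) * x ^ n)) \<le> ennreal (C * (1 - x) powr (- \<mu>))"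
    "\<And>x. 1 \<le> x \<Longrightarrow> (\<Sum>n. ennreal (bergman_diag (0, n) powr ((1 - \<mu>) / 2) * x ^ n)) = \<infinity>"
proof -
  define w where "w n = bergman_diag (0, n) powr ((1 - \<mu>) / 2)" for n
  define b where "b n = pochhammer \<mu> n / fact n" for n
  obtain c1 C1 where 1: "c1 > 0" "C1 > 0" "\<And>n. c1 * (real n + 1) powr (\<mu> - 1) \<le> w n"
    "\<And>n. w n \<le> C1 * (real n + 1) powr (\<mu> - 1)"
  proof -
    have "- 2 * ((1 - \<mu>) / 2) = \<mu> - 1" by simp
    with bergman_diag_powr_bounds[of "(1 - \<mu>) / 2"] that show ?thesis unfolding w_def by metis
  qed
  obtain c2 C2 where 2: "c2 > 0" "C2 > 0" "\<And>n. c2 * b n \<le> (real n + 1) powr (\<mu> - 1)"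
    "\<And>n. (real n + 1) powr (\<mu> - 1) \<le> C2 * b n"
    using pochhammer_powr_bounds[OF \<mu>] unfolding b_def by metis
  have lo: "c1 * c2 * b n \<le> w n" for n
    using order_trans[OF mult_left_mono[OF 2(3)[of n] less_imp_le[OF 1(1)]] 1(3)] by (simp only: mult.assoc)
  have hi: "w n \<le> C1 * C2 * b n" for n
    using order_trans[OF 1(4) mult_left_mono[OF 2(4)[of n] less_imp_le[OF 1(2)]]] by (simp only: mult.assoc)
  have sum_b: "(\<Sum>n. ennreal (k * b n * x ^ n)) = ennreal (k * (1 - x) powr (- \<mu>))"
    if "0 \<le> x" "x < 1" "k > 0" for k x
  proof (rule suminf_ennreal_eq)
    show "0 \<le> k * b n * x ^ n" for n
      using that \<mu> pochhammer_pos[of \<mu> n] by (simp add: b_def)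
    show "(\<lambda>n. k * b n * x ^ n) sums (k * (1 - x) powr (- \<mu>))"
      using sums_mult[OF pochhammer_binomial_sums[OF that(1,2), of \<mu>], of k] by (simp add: b_def mult.assoc)
  qed
  show thesis
  proof
    show "c1 * c2 > 0" "C1 * C2 > 0" using 1 2 by auto
    fix x :: real
    show "ennreal (c1 * c2 * (1 - x) powr (- \<mu>)) \<le> (\<Sum>n. ennreal (bergman_diag (0, n) powr ((1 - \<mu>) / 2) * x ^ n))"
      if x: "0 \<le> x" "x < 1"
      unfolding w_def[symmetric] sum_b[OF x \<open>c1 * c2 > 0\<close>, symmetric]
      using lo x by (intro suminf_le ennreal_leI mult_right_mono) auto
    show "(\<Sum>n. ennreal (bergman_diag (0, n) powr ((1 - \<mu>) / 2) * x ^ n)) \<le> ennreal (C1 * C2 * (1 - x) powr (- \<mu>))"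
      if x: "0 \<le> x" "x < 1"
      unfolding w_def[symmetric] sum_b[OF x \<open>C1 * C2 > 0\<close>, symmetric]
      using hi x by (intro suminf_le ennreal_leI mult_right_mono) auto
    show "(\<Sum>n. ennreal (bergman_diag (0, n) powr ((1 - \<mu>) / 2) * x ^ n)) = \<infinity>" if x: "1 \<le> x"
    proof (rule ccontr)
      assume "\<not> ?thesis"
      then have s: "summable (\<lambda>n. w n * x ^ n)"
        unfolding w_def[symmetric] using x
        by (intro summable_suminf_not_top) (auto simp: w_def)
      have "summable (\<lambda>n. c1 * (real n + 1) powr (\<mu> - 1))"
      proof (rule summable_comparison_test'[OF s])
        fix n
        have "w n * 1 \<le> w n * x ^ n"
          using x by (intro mult_left_mono) (auto simp: w_def)
        then show "norm (c1 * (real n + 1) powr (\<mu> - 1)) \<le> w n * x ^ n"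
          using 1(1) 1(3)[of n] by simp
      qed
      then have "summable (\<lambda>n. real (Suc n) powr (\<mu> - 1))"
        using 1(1) by (subst (asm) summable_cmult_iff) (auto simp: add.commute)
      then have "summable (\<lambda>n. real n powr (\<mu> - 1))"
        by (subst (asm) summable_Suc_iff)
      then show False using \<mu> by (simp add: summable_real_powr_iff)
    qed
  qed
qed

section \<open>Weighted Bergman spaces in Fourier form\<close>

lemma borel_imp_circ_measurable: "f \<in> borel_measurable borel \<Longrightarrow> f \<in> borel_measurable circ"
  by (intro measurable_restrict_space1 measurable_completion) simp

lemma mult_q_measurable [measurable]: "mult_q \<in> borel_measurable borel"
  unfolding mult_q_def by measurable

lemma mult_q_power_measurable: "(\<lambda>t. complex_of_real (mult_q t) ^ n) \<in> borel_measurable circ"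
  by (rule borel_imp_circ_measurable) measurable

lemma norm_mult_q_power: "(cmod (of_real (mult_q t) ^ n))\<^sup>2 = ((mult_q t)\<^sup>2) ^ n"
proof -
  have "(cmod (of_real (mult_q t) ^ n))\<^sup>2 = (\<bar>mult_q t\<bar> ^ n)\<^sup>2" by (simp add: norm_power)
  also have "\<dots> = (\<bar>mult_q t\<bar>\<^sup>2) ^ n" by (simp only: power_mult[symmetric] mult.commute)
  finally show ?thesis by simp
qed

lemma mult_q_sq:
  assumes "t \<in> {0<..<pi}"
  shows "0 \<le> (mult_q t)\<^sup>2" "(mult_q t)\<^sup>2 < 1"
    "(1 - (mult_q t)\<^sup>2) powr - \<mu> = ((1 + sin t) / (2 * sin t)) powr \<mu>"
proof -
  have s: "sin t > 0" using assms by (intro sin_gt_zero) auto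
  then have eq: "1 - (mult_q t)\<^sup>2 = 2 * sin t / (1 + sin t)" by (intro one_minus_mult_q_sq) auto
  have "2 * sin t / (1 + sin t) > 0" using s by simp
  with eq show "(mult_q t)\<^sup>2 < 1" by linarith
  show "(1 - (mult_q t)\<^sup>2) powr - \<mu> = ((1 + sin t) / (2 * sin t)) powr \<mu>"
    unfolding eq using s by (simp add: powr_minus powr_divide)
qed simp

lemma sin_neq_minus_1:
  assumes "t \<in> {-pi..pi}" "t \<noteq> - (pi / 2)" shows "sin t \<noteq> -1"
proof
  assume "sin t = -1"
  then have "cos (t + pi / 2) = 1" by (simp add: cos_add)
  then obtain k :: int where k: "t + pi / 2 = real_of_int k * (2 * pi)" unfolding cos_one_2pi_int by (auto simp: mult.assoc)
  have "k = 0"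
  proof (rule ccontr)
    assume "k \<noteq> 0"
    then consider "k \<ge> 1" | "k \<le> -1" by linarith
    then show False
    proof cases
      case 1
      then have "1 * (2 * pi) \<le> real_of_int k * (2 * pi)" by (intro mult_right_mono) auto
      with k assms(1) pi_gt_zero show False unfolding atLeastAtMost_iff by linarith
    next
      case 2
      then have "real_of_int k * (2 * pi) \<le> (-1) * (2 * pi)" by (intro mult_right_mono) auto
      with k assms(1) pi_gt_zero show False unfolding atLeastAtMost_iff by linarith
    qed
  qed
  with k assms(2) show False by simp
qed

text \<open>Here \<open>sin t < 0\<close> makes \<open>1 - q^2\<close> nonpositive. At -pi/2
  division by zero would give \<open>q = 0\<close>, hence the excluded point.\<close>

lemma mult_q_sq_ge_1:
  assumes "t \<in> {-pi<..<0}" "t \<noteq> - (pi / 2)" shows "1 \<le> (mult_q t)\<^sup>2"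
proof -
  have ne: "sin t \<noteq> -1" using assms by (intro sin_neq_minus_1) auto
  have "sin t > -1" using ne sin_ge_minus_one[of t] by linarith
  moreover have "sin t < 0" using sin_gt_zero[of "- t"] assms by simp
  ultimately have "2 * sin t / (1 + sin t) \<le> 0" by (simp add: divide_le_0_iff)
  then show ?thesis using one_minus_mult_q_sq[OF ne] by linarith
qed

text \<open>In terms of symbols, discrete holomorphy says that row \<open>n\<close> times \<open>1 + \<i> e\<^sup>i\<^sup>t\<close> equals
  row \<open>n + 1\<close> times \<open>e\<^sup>i\<^sup>t + \<i>\<close>.\<close>

lemma mult_q_symbol:
  assumes "sin t \<noteq> -1"
  shows "1 + \<i> * cis t = of_real (mult_q t) * (cis t + \<i>)"
proof -
  have s: "1 + sin t \<noteq> 0" using assms by linarith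
  have "mult_q t * cos t * (1 + sin t) = (cos t)\<^sup>2"
    using s by (simp add: mult_q_def power2_eq_square)
  also have "\<dots> = (1 - sin t) * (1 + sin t)"
    by (simp add: cos_squared_eq power2_eq_square algebra_simps)
  finally have "mult_q t * cos t * (1 + sin t) = (1 - sin t) * (1 + sin t)" .
  then have "mult_q t * cos t = 1 - sin t" using s by simp
  moreover have "mult_q t * (1 + sin t) = cos t" using s by (simp add: mult_q_def)
  ultimately show ?thesis by (simp add: complex_eq_iff add.commute)
qed

text \<open>Multiplication by \<open>cis t\<close> shifts the coefficients by one. Applied to the
  symbols of rows \<open>n\<close> and \<open>n + 1\<close>, the right-hand sides are the two halves
  of the equation in \<open>Hol\<close>.\<close>

lemma fcoef_mult_symbol:
  assumes "integrable circ h"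
  shows "fcoef (\<lambda>t. h t * (1 + \<i> * cis t)) m = fcoef h m + \<i> * fcoef h (m + 1)"
    and "fcoef (\<lambda>t. h t * (cis t + \<i>)) m = fcoef h (m + 1) + \<i> * fcoef h m"
proof -
  have i: "integrable circ (\<lambda>t. h t * cis t)" using integrable_mult_cis[OF assms, of 1] by simp
  have "fcoef (\<lambda>t. h t * (1 + \<i> * cis t)) m = fcoef (\<lambda>t. h t + \<i> * (h t * cis t)) m"
    by (simp add: algebra_simps)
  also have "\<dots> = fcoef h m + \<i> * fcoef h (m + 1)"
    using assms i by (subst fcoef_add) (auto simp: fcoef_cmult fcoef_mult_cis)
  finally show "fcoef (\<lambda>t. h t * (1 + \<i> * cis t)) m = fcoef h m + \<i> * fcoef h (m + 1)" .
  have "fcoef (\<lambda>t. h t * (cis t + \<i>)) m = fcoef (\<lambda>t. h t * cis t + \<i> * h t) m"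
    by (simp add: algebra_simps)
  also have "\<dots> = fcoef h (m + 1) + \<i> * fcoef h m"
    using assms i by (subst fcoef_add) (auto simp: fcoef_cmult fcoef_mult_cis)
  finally show "fcoef (\<lambda>t. h t * (cis t + \<i>)) m = fcoef h (m + 1) + \<i> * fcoef h m" .
qed

lemma infsum_ennreal_cmult_right:
  fixes f :: "'a \<Rightarrow> ennreal"
  shows "(\<Sum>\<^sub>\<infinity>x\<in>A. f x * c) = (\<Sum>\<^sub>\<infinity>x\<in>A. f x) * c"
  unfolding infsum_ennreal_eq_SUP sum_distrib_right[symmetric]
  by (rule SUP_mult_right_ennreal[symmetric])

text \<open>This is the weight \<open>W\<close>. Column 0 represents all columns, as
  \<open>bergman_diag\<close> ignores its first argument; values in \<open>ennreal\<close> admit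
  divergence.\<close>

definition weight_sum :: "real \<Rightarrow> real \<Rightarrow> ennreal" where
  "weight_sum \<mu> t = (\<Sum>n. ennreal (bergman_diag (0, n) powr ((1 - \<mu>) / 2) * ((mult_q t)\<^sup>2) ^ n))"

lemma weight_sum_measurable [measurable]: "weight_sum \<mu> \<in> borel_measurable borel"
  unfolding weight_sum_def by measurable

lemma norm_sq_measurable:
  "h \<in> borel_measurable M \<Longrightarrow> (\<lambda>t. ennreal ((cmod (h t))\<^sup>2)) \<in> borel_measurable M"
  by measurable

text \<open>Parseval on each row, then interchange of sum and integral of nonnegative terms. The
  equation also covers infinite values, so it can be used to test membership.\<close>

lemma A2_normsq_eq:
  assumes g: "g \<in> borel_measurable circ"
    and sq: "\<And>n. sq_int (\<lambda>t. g t * of_real (mult_q t) ^ n)"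
    and f: "\<And>m n. f (m, n) = fcoef (\<lambda>t. g t * of_real (mult_q t) ^ n) m"
  shows "A2_normsq ((1 - \<mu>) / 2) f = (\<integral>\<^sup>+t. ennreal ((cmod (g t))\<^sup>2) * weight_sum \<mu> t \<partial>circ)"
proof -
  define w where "w n = bergman_diag (0, n) powr ((1 - \<mu>) / 2)" for n
  have w: "bergman_diag (m, n) powr ((1 - \<mu>) / 2) = w n" "0 \<le> w n" for m n
    by (simp_all add: w_def bergman_diag_def)
  have "A2_normsq ((1 - \<mu>) / 2) f = (\<Sum>n. \<integral>\<^sup>+t. ennreal ((cmod (g t))\<^sup>2) * ennreal (w n * ((mult_q t)\<^sup>2) ^ n) \<partial>circ)"
    unfolding A2_normsq_def w(1)
  proof (rule suminf_cong)
    fix n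
    have "(\<Sum>\<^sub>\<infinity>m. ennreal ((cmod (f (m, n)))\<^sup>2 * w n)) = (\<Sum>\<^sub>\<infinity>m. ennreal ((cmod (f (m, n)))\<^sup>2) * ennreal (w n))"
      by (simp add: ennreal_mult w(2))
    also have "\<dots> = (\<integral>\<^sup>+t. ennreal ((cmod (g t * of_real (mult_q t) ^ n))\<^sup>2) \<partial>circ) * ennreal (w n)"
      unfolding infsum_ennreal_cmult_right f Parseval[OF sq] ..
    also have "\<dots> = (\<integral>\<^sup>+t. ennreal ((cmod (g t * of_real (mult_q t) ^ n))\<^sup>2) * ennreal (w n) \<partial>circ)"
      using sq[of n] by (intro nn_integral_multc[symmetric] norm_sq_measurable) (simp add: sq_int_def)
    also have "\<dots> = (\<integral>\<^sup>+t. ennreal ((cmod (g t))\<^sup>2) * ennreal (w n * ((mult_q t)\<^sup>2) ^ n) \<partial>circ)"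
    proof (rule nn_integral_cong)
      fix t
      have "ennreal ((cmod (g t * of_real (mult_q t) ^ n))\<^sup>2) = ennreal ((cmod (g t))\<^sup>2) * ennreal (((mult_q t)\<^sup>2) ^ n)"
        unfolding norm_mult power_mult_distrib norm_mult_q_power by (rule ennreal_mult) auto
      moreover have "ennreal (w n * ((mult_q t)\<^sup>2) ^ n) = ennreal (w n) * ennreal (((mult_q t)\<^sup>2) ^ n)"
        by (rule ennreal_mult) (auto simp: w(2))
      ultimately show "ennreal ((cmod (g t * of_real (mult_q t) ^ n))\<^sup>2) * ennreal (w n) =
          ennreal ((cmod (g t))\<^sup>2) * ennreal (w n * ((mult_q t)\<^sup>2) ^ n)"
        by (simp only: mult_ac)
    qed
    finally show "(\<Sum>\<^sub>\<infinity>m. ennreal ((cmod (f (m, n)))\<^sup>2 * w n)) =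
      (\<integral>\<^sup>+t. ennreal ((cmod (g t))\<^sup>2) * ennreal (w n * ((mult_q t)\<^sup>2) ^ n) \<partial>circ)" .
  qed
  also have "\<dots> = (\<integral>\<^sup>+t. (\<Sum>n. ennreal ((cmod (g t))\<^sup>2) * ennreal (w n * ((mult_q t)\<^sup>2) ^ n)) \<partial>circ)"
  proof (rule nn_integral_suminf[symmetric], rule borel_measurable_times_ennreal[OF norm_sq_measurable[OF g]])
    show "(\<lambda>t. ennreal (w n * ((mult_q t)\<^sup>2) ^ n)) \<in> borel_measurable circ" for n
      by (rule borel_imp_circ_measurable) measurable
  qed
  finally show ?thesis unfolding weight_sum_def w_def by simp
qed

section \<open>From a symbol in X to a discrete holomorphic function\<close>

text \<open>Extension by 0 turns the integrals over [0, pi] in \<open>X_normsq\<close> and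
  \<open>inv_fourier\<close> into integrals over the whole circle, where \<open>fcoef\<close> and
  Parseval apply.\<close>

definition half_cut :: "(real \<Rightarrow> complex) \<Rightarrow> real \<Rightarrow> complex" where
  "half_cut g t = (if t \<in> {0..pi} then g t else 0)"

lemma half_cut_measurable:
  assumes "g \<in> borel_measurable circ" shows "half_cut g \<in> borel_measurable circ"
proof -
  have "{0..pi} \<inter> {-pi..pi} \<in> sets lebesgue" by auto
  then have "{0..pi} \<inter> space circ \<in> sets circ"
    by (auto simp: sets_restrict_space intro!: image_eqI[of _ _ "{0..pi}"])
  then show ?thesis unfolding half_cut_def using assms
    by (intro measurable_If_set) auto
qed

lemma X_normsq_eq:
  "X_normsq \<mu> g = (\<integral>\<^sup>+t. ennreal ((cmod (half_cut g t))\<^sup>2) * ennreal (((1 + sin t) / (2 * sin t)) powr \<mu>) \<partial>circ)"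
  unfolding X_normsq_def
  by (subst nn_integral_restrict_space)
    (auto simp: half_cut_def ennreal_mult'' indicator_def intro!: nn_integral_cong)

lemma inv_fourier_eq_fcoef:
  "inv_fourier g (m, n) = fcoef (\<lambda>t. half_cut g t * of_real (mult_q t) ^ n) m"
proof -
  have "(LINT t:{0..pi}|lebesgue. g t * exp (\<i> * of_int m * of_real t) * of_real (cos t / (1 + sin t)) ^ n)
    = (\<integral>t. indicator {-pi..pi} t *\<^sub>R (half_cut g t * of_real (mult_q t) ^ n * cis (of_int m * t)) \<partial>lebesgue)"
    unfolding set_lebesgue_integral_def
    by (rule Bochner_Integration.integral_cong)
      (auto simp: half_cut_def mult_q_def cis_conv_exp indicator_def mult_ac)
  then show ?thesis
    unfolding inv_fourier_def fcoef_def by (subst integral_restrict_space) auto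
qed

text \<open>The discarded points are the zeros of \<open>sin\<close>, where the weight of
  \<open>X\<close> degenerates, and -pi/2, where the denominator of \<open>q\<close>
  vanishes.\<close>

lemma AE_circ_cases:
  assumes "\<And>t. t \<in> {0<..<pi} \<Longrightarrow> P t" "\<And>t. t \<in> {-pi<..<0} \<Longrightarrow> t \<noteq> - (pi / 2) \<Longrightarrow> P t"
  shows "AE t in circ. P t"
proof -
  have "AE t in circ. t \<noteq> 0 \<and> t \<noteq> pi \<and> t \<noteq> -pi \<and> t \<noteq> - (pi / 2)"
    using AE_circ_neq[of 0] AE_circ_neq[of pi] AE_circ_neq[of "-pi"] AE_circ_neq[of "- (pi / 2)"]
    by eventually_elim auto
  then show ?thesis
  proof (rule lebesgue_on_mono)
    fix t assume "t \<noteq> 0 \<and> t \<noteq> pi \<and> t \<noteq> -pi \<and> t \<noteq> - (pi / 2)" "t \<in> {-pi..pi}"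
    then show "P t" using assms(1)[of t] assms(2)[of t] by (cases "t > 0") auto
  qed
qed

text \<open>On (0, pi) both \<open>q^(2n) \<le> 1\<close> and, as \<open>\<mu> > 0\<close>, the
  weight of \<open>X \<mu>\<close> is at least 1.\<close>

lemma sq_int_half_cut:
  assumes \<mu>: "\<mu> > 0" and g: "g \<in> X \<mu>"
  shows "sq_int (\<lambda>t. half_cut g t * of_real (mult_q t) ^ n)"
  unfolding sq_int_iff_nn
proof
  have m: "g \<in> borel_measurable circ" and fin: "X_normsq \<mu> g < \<infinity>" using g by (auto simp: X_def)
  show "(\<lambda>t. half_cut g t * of_real (mult_q t) ^ n) \<in> borel_measurable circ"
    by (rule borel_measurable_times[OF half_cut_measurable[OF m] mult_q_power_measurable])
  have "(\<integral>\<^sup>+t. ennreal ((cmod (half_cut g t * of_real (mult_q t) ^ n))\<^sup>2) \<partial>circ) \<le> X_normsq \<mu> g"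
    unfolding X_normsq_eq
  proof (intro nn_integral_mono_AE AE_circ_cases)
    fix t assume t: "t \<in> {0<..<pi}"
    have s: "sin t > 0" using t by (intro sin_gt_zero) auto
    have "(cmod (of_real (mult_q t) ^ n))\<^sup>2 = ((mult_q t)\<^sup>2) ^ n" by (rule norm_mult_q_power)
    also have "\<dots> \<le> 1" by (rule power_le_one[OF mult_q_sq(1)[OF t] less_imp_le[OF mult_q_sq(2)[OF t]]])
    also have "1 \<le> ((1 + sin t) / (2 * sin t)) powr \<mu>"
      using s \<mu> by (intro ge_one_powr_ge_zero) auto
    finally have "(cmod (half_cut g t))\<^sup>2 * (cmod (of_real (mult_q t) ^ n))\<^sup>2 \<le> (cmod (half_cut g t))\<^sup>2 * ((1 + sin t) / (2 * sin t)) powr \<mu>"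
      by (intro mult_left_mono) auto
    then show "ennreal ((cmod (half_cut g t * of_real (mult_q t) ^ n))\<^sup>2) \<le>
      ennreal ((cmod (half_cut g t))\<^sup>2) * ennreal (((1 + sin t) / (2 * sin t)) powr \<mu>)"
      unfolding norm_mult power_mult_distrib by (subst ennreal_mult[symmetric]) (auto intro: ennreal_leI)
  next
    fix t assume "t \<in> {-pi<..<0}"
    then show "ennreal ((cmod (half_cut g t * of_real (mult_q t) ^ n))\<^sup>2) \<le>
      ennreal ((cmod (half_cut g t))\<^sup>2) * ennreal (((1 + sin t) / (2 * sin t)) powr \<mu>)"
      by (simp add: half_cut_def)
  qed
  then show "(\<integral>\<^sup>+t. ennreal ((cmod (half_cut g t * of_real (mult_q t) ^ n))\<^sup>2) \<partial>circ) < \<infinity>"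
    using fin by (rule le_less_trans)
qed

text \<open>The symbol identity for neighbouring rows holds at every t: on [0, pi] by
  \<open>mult_q_symbol\<close>, elsewhere because both sides are 0.\<close>

lemma inv_fourier_Hol:
  assumes \<mu>: "\<mu> > 0" and g: "g \<in> X \<mu>"
  shows "inv_fourier g \<in> Hol"
  unfolding Hol_def
proof (intro CollectI allI)
  fix m n
  let ?h = "\<lambda>n t. half_cut g t * of_real (mult_q t) ^ n"
  have i: "integrable circ (?h n)" for n by (rule sq_int_integrable[OF sq_int_half_cut[OF \<mu> g]])
  have "?h n t * (1 + \<i> * cis t) = ?h (n + 1) t * (cis t + \<i>)" for t
  proof (cases "t \<in> {0..pi}")
    case True
    then have "sin t \<noteq> -1" using sin_Icc_nonneg[of t] by auto
    then show ?thesis by (subst mult_q_symbol) auto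
  qed (auto simp: half_cut_def)
  then have "fcoef (\<lambda>t. ?h n t * (1 + \<i> * cis t)) m = fcoef (\<lambda>t. ?h (n + 1) t * (cis t + \<i>)) m" by (simp only:)
  then have "fcoef (?h n) m + \<i> * fcoef (?h n) (m + 1) = fcoef (?h (n + 1)) (m + 1) + \<i> * fcoef (?h (n + 1)) m"
    unfolding fcoef_mult_symbol[OF i] .
  then show "inv_fourier g (m, n) + \<i> * inv_fourier g (m + 1, n) - inv_fourier g (m + 1, n + 1) - \<i> * inv_fourier g (m, n + 1) = 0"
    unfolding inv_fourier_eq_fcoef by (simp add: algebra_simps)
qed

section \<open>Recovering the symbol of a function in A2\<close>

text \<open>A single row is one term of the norm, and its weight is a positive constant that can be
  divided out; Riesz-Fischer then applies. The symbols of different rows are still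
  unrelated.\<close>

lemma A2_rows:
  assumes f: "f \<in> A2 ((1 - \<mu>) / 2)"
  obtains g where "\<And>n. sq_int (g n)" "\<And>m n. fcoef (g n) m = f (m, n)"
proof -
  have "\<exists>h. sq_int h \<and> (\<forall>m. fcoef h m = f (m, n))" for n
  proof -
    define b where "b = bergman_diag (0, n) powr ((1 - \<mu>) / 2)"
    have b: "b > 0" using bergman_diag_pos[of 0 n] by (simp add: b_def)
    define S where "S = (\<Sum>\<^sub>\<infinity>m. ennreal ((cmod (f (m, n)))\<^sup>2 * b))"
    have "S \<le> A2_normsq ((1 - \<mu>) / 2) f"
      unfolding A2_normsq_def S_def b_def
      using sum_le_suminf[of "\<lambda>n. \<Sum>\<^sub>\<infinity>m. ennreal ((cmod (f (m, n)))\<^sup>2 * bergman_diag (m, n) powr ((1 - \<mu>) / 2))" "{n}"]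
      by (simp add: bergman_diag_def)
    then have "S < \<infinity>" using f by (auto simp: A2_def intro: le_less_trans)
    then obtain s where s: "S = ennreal s" "s \<ge> 0" by (cases S) auto
    have "(\<Sum>m\<in>F. (cmod (f (m, n)))\<^sup>2) \<le> s / b" if "finite F" for F
    proof -
      have "ennreal (\<Sum>m\<in>F. (cmod (f (m, n)))\<^sup>2 * b) = (\<Sum>m\<in>F. ennreal ((cmod (f (m, n)))\<^sup>2 * b))"
        using b by (simp add: sum_ennreal)
      also have "\<dots> \<le> S" unfolding S_def infsum_ennreal_eq_SUP using that by (intro SUP_upper) auto
      finally have "(\<Sum>m\<in>F. (cmod (f (m, n)))\<^sup>2) * b \<le> s" using s by (simp add: sum_distrib_right)
      then show ?thesis using b by (simp add: pos_le_divide_eq)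
    qed
    then show ?thesis using Riesz_Fischer[of "\<lambda>m. f (m, n)"] by metis
  qed
  then show thesis using that by metis
qed

text \<open>By uniqueness, discrete holomorphy becomes
  \<open>g n * (1 + \<i> cis t) = g (n + 1) * (cis t + \<i>)\<close> almost everywhere. Off -pi/2
  the last factor can be divided out, and induction expresses all rows through
  \<open>g 0\<close>.\<close>

lemma A2_symbol:
  assumes f: "f \<in> A2 ((1 - \<mu>) / 2)"
  obtains g where "\<And>n. sq_int (\<lambda>t. g t * of_real (mult_q t) ^ n)"
    "\<And>m n. f (m, n) = fcoef (\<lambda>t. g t * of_real (mult_q t) ^ n) m"
proof -
  obtain g where sq: "\<And>n. sq_int (g n)" and g: "\<And>m n. fcoef (g n) m = f (m, n)"
    using A2_rows[OF assms] by metis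
  have i: "integrable circ (g n)" for n by (rule sq_int_integrable[OF sq])
  have cis_m [measurable]: "cis \<in> borel_measurable circ" using measurable_circ_cis[of 1] by simp
  have "AE t in circ. g n t * (1 + \<i> * cis t) = g (n + 1) t * (cis t + \<i>)" for n
  proof (rule L2_uniqueness)
    have "cmod (1 + \<i> * cis t) \<le> 2" "cmod (cis t + \<i>) \<le> 2" for t
      using norm_triangle_ineq[of 1 "\<i> * cis t"] norm_triangle_ineq[of "cis t" \<i>] by (auto simp: norm_mult)
    then show "sq_int (\<lambda>t. g n t * (1 + \<i> * cis t))" "sq_int (\<lambda>t. g (n + 1) t * (cis t + \<i>))"
      by (auto intro!: sq_int_mult_bounded[OF sq])
    fix m
    have "f (m, n) + \<i> * f (m + 1, n) - f (m + 1, n + 1) - \<i> * f (m, n + 1) = 0"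
      using f by (simp add: A2_def Hol_def)
    then show "fcoef (\<lambda>t. g n t * (1 + \<i> * cis t)) m = fcoef (\<lambda>t. g (n + 1) t * (cis t + \<i>)) m"
      unfolding fcoef_mult_symbol[OF i] g by (simp add: algebra_simps)
  qed
  \<comment> \<open>The countably many exceptional sets are merged first, so that the induction runs
    at a fixed t.\<close>
  then have "AE t in circ. \<forall>n. g n t * (1 + \<i> * cis t) = g (n + 1) t * (cis t + \<i>)"
    by (simp add: AE_all_countable)
  moreover have "AE t in circ. sin t \<noteq> -1"
    by (rule lebesgue_on_mono[OF AE_circ_neq[of "- (pi / 2)"]]) (rule sin_neq_minus_1)
  ultimately have "AE t in circ. \<forall>n. g n t = g 0 t * of_real (mult_q t) ^ n"
  proof eventually_elim
    case (elim t)
    have ne: "cis t + \<i> \<noteq> 0" using elim(2) by (auto simp: complex_eq_iff)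
    have "g n t = g 0 t * of_real (mult_q t) ^ n" for n
    proof (induction n)
      case (Suc n)
      have "g (Suc n) t * (cis t + \<i>) = g n t * of_real (mult_q t) * (cis t + \<i>)"
        using spec[OF elim(1), of n] unfolding mult_q_symbol[OF elim(2)] by (simp only: mult.assoc Suc_eq_plus1)
      with ne Suc show ?case by (simp add: mult_ac)
    qed simp
    then show ?case by blast
  qed
  then have AE: "AE t in circ. g n t = g 0 t * of_real (mult_q t) ^ n" for n
    by (auto simp: AE_all_countable)
  have m: "g n \<in> borel_measurable circ" for n using sq by (simp add: sq_int_def)
  have m': "(\<lambda>t. g 0 t * of_real (mult_q t) ^ n) \<in> borel_measurable circ" for n
    by (rule borel_measurable_times[OF m mult_q_power_measurable])
  show thesis
  proof
    fix n
    have "(\<integral>\<^sup>+t. ennreal ((cmod (g 0 t * of_real (mult_q t) ^ n))\<^sup>2) \<partial>circ) = (\<integral>\<^sup>+t. ennreal ((cmod (g n t))\<^sup>2) \<partial>circ)"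
      using AE[of n] by (intro nn_integral_cong_AE) auto
    then show "sq_int (\<lambda>t. g 0 t * of_real (mult_q t) ^ n)"
      using sq[of n] m' by (simp add: sq_int_iff_nn)
    show "f (m, n) = fcoef (\<lambda>t. g 0 t * of_real (mult_q t) ^ n) m" for m
      unfolding g[symmetric] by (rule fcoef_cong_AE[OF AE m m'])
  qed
qed

section \<open>Equality of the spaces and equivalence of the norms\<close>

theorem proposition8p3:
  fixes \<mu> :: real
  assumes "\<mu> > 0"
  shows "tilde_A2 \<mu> = A2 ((1 - \<mu>) / 2) \<and>
    (\<exists>c C. c > 0 \<and> C > 0 \<and>
      (\<forall>f \<in> tilde_A2 \<mu>. c * A2_norm ((1 - \<mu>) / 2) f \<le> tilde_A2_norm \<mu> f \<and>
                         tilde_A2_norm \<mu> f \<le> C * A2_norm ((1 - \<mu>) / 2) f))"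
proof -
  let ?\<nu> = "(1 - \<mu>) / 2"
  let ?V = "\<lambda>t. ennreal (((1 + sin t) / (2 * sin t)) powr \<mu>)"
  obtain c C where c: "c > 0" "C > 0"
    and lo: "\<And>t. t \<in> {0<..<pi} \<Longrightarrow> ennreal c * ?V t \<le> weight_sum \<mu> t"
    and hi: "\<And>t. t \<in> {0<..<pi} \<Longrightarrow> weight_sum \<mu> t \<le> ennreal C * ?V t"
    and top: "\<And>t. t \<in> {-pi<..<0} \<Longrightarrow> t \<noteq> - (pi / 2) \<Longrightarrow> weight_sum \<mu> t = \<infinity>"
  proof (rule weight_sum_bounds[OF assms])
    fix c C assume *: "c > 0" "C > 0"
      "\<And>x. 0 \<le> x \<Longrightarrow> x < 1 \<Longrightarrow> ennreal (c * (1 - x) powr (- \<mu>)) \<le> (\<Sum>n. ennreal (bergman_diag (0, n) powr ?\<nu> * x ^ n))"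
      "\<And>x. 0 \<le> x \<Longrightarrow> x < 1 \<Longrightarrow> (\<Sum>n. ennreal (bergman_diag (0, n) powr ?\<nu> * x ^ n)) \<le> ennreal (C * (1 - x) powr (- \<mu>))"
      "\<And>x. 1 \<le> x \<Longrightarrow> (\<Sum>n. ennreal (bergman_diag (0, n) powr ?\<nu> * x ^ n)) = \<infinity>"
    show thesis
    proof (rule that[OF *(1,2)])
      fix t assume t: "t \<in> {0<..<pi}"
      show "ennreal c * ?V t \<le> weight_sum \<mu> t"
        using *(3)[OF mult_q_sq(1,2)[OF t]] *(1) unfolding mult_q_sq(3)[OF t] weight_sum_def
        by (simp add: ennreal_mult)
      show "weight_sum \<mu> t \<le> ennreal C * ?V t"
        using *(4)[OF mult_q_sq(1,2)[OF t]] *(2) unfolding mult_q_sq(3)[OF t] weight_sum_def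
        by (simp add: ennreal_mult)
    next
      fix t assume "t \<in> {-pi<..<0}" "t \<noteq> - (pi / 2)"
      from *(5)[OF mult_q_sq_ge_1[OF this]] show "weight_sum \<mu> t = \<infinity>" unfolding weight_sum_def .
    qed
  qed
  \<comment> \<open>Stated for all measurable \<open>g\<close>: the lower bound is what later proves
    that a symbol recovered from \<open>A2\<close> belongs to \<open>X \<mu>\<close>.\<close>
  have cut_lo: "ennreal c * X_normsq \<mu> g \<le> (\<integral>\<^sup>+t. ennreal ((cmod (half_cut g t))\<^sup>2) * weight_sum \<mu> t \<partial>circ)"
    and cut_hi: "(\<integral>\<^sup>+t. ennreal ((cmod (half_cut g t))\<^sup>2) * weight_sum \<mu> t \<partial>circ) \<le> ennreal C * X_normsq \<mu> g"
    if "g \<in> borel_measurable circ" for g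
  proof -
    have "?V \<in> borel_measurable circ" by (rule borel_imp_circ_measurable) measurable
    then have meas: "(\<lambda>t. ennreal ((cmod (half_cut g t))\<^sup>2) * ?V t) \<in> borel_measurable circ"
      by (rule borel_measurable_times_ennreal[OF norm_sq_measurable[OF half_cut_measurable[OF that]]])
    have 0: "half_cut g t = 0" if "t \<in> {-pi<..<0}" for t using that by (auto simp: half_cut_def)
    have "ennreal c * X_normsq \<mu> g = (\<integral>\<^sup>+t. ennreal c * (ennreal ((cmod (half_cut g t))\<^sup>2) * ?V t) \<partial>circ)"
      unfolding X_normsq_eq by (rule nn_integral_cmult[OF meas, symmetric])
    also have "\<dots> \<le> (\<integral>\<^sup>+t. ennreal ((cmod (half_cut g t))\<^sup>2) * weight_sum \<mu> t \<partial>circ)"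
      by (intro nn_integral_mono_AE AE_circ_cases)
        (auto simp: 0 mult.left_commute[of "ennreal c"] intro!: mult_left_mono lo)
    finally show "ennreal c * X_normsq \<mu> g \<le> (\<integral>\<^sup>+t. ennreal ((cmod (half_cut g t))\<^sup>2) * weight_sum \<mu> t \<partial>circ)" .
    have "(\<integral>\<^sup>+t. ennreal ((cmod (half_cut g t))\<^sup>2) * weight_sum \<mu> t \<partial>circ) \<le> (\<integral>\<^sup>+t. ennreal C * (ennreal ((cmod (half_cut g t))\<^sup>2) * ?V t) \<partial>circ)"
      by (intro nn_integral_mono_AE AE_circ_cases)
        (auto simp: 0 mult.left_commute[of "ennreal C"] intro!: mult_left_mono hi)
    also have "\<dots> = ennreal C * X_normsq \<mu> g"
      unfolding X_normsq_eq by (rule nn_integral_cmult[OF meas])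
    finally show "(\<integral>\<^sup>+t. ennreal ((cmod (half_cut g t))\<^sup>2) * weight_sum \<mu> t \<partial>circ) \<le> ennreal C * X_normsq \<mu> g" .
  qed
  have equiv: "ennreal c * X_normsq \<mu> g \<le> A2_normsq ?\<nu> (inv_fourier g)"
    "A2_normsq ?\<nu> (inv_fourier g) \<le> ennreal C * X_normsq \<mu> g" if g: "g \<in> X \<mu>" for g
  proof -
    have m: "g \<in> borel_measurable circ" using g by (simp add: X_def)
    have "A2_normsq ?\<nu> (inv_fourier g) = (\<integral>\<^sup>+t. ennreal ((cmod (half_cut g t))\<^sup>2) * weight_sum \<mu> t \<partial>circ)"
      by (rule A2_normsq_eq[OF half_cut_measurable[OF m] sq_int_half_cut[OF assms g] inv_fourier_eq_fcoef])
    then show "ennreal c * X_normsq \<mu> g \<le> A2_normsq ?\<nu> (inv_fourier g)"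
      "A2_normsq ?\<nu> (inv_fourier g) \<le> ennreal C * X_normsq \<mu> g"
      using cut_lo[OF m] cut_hi[OF m] by auto
  qed
  have "tilde_A2 \<mu> = A2 ?\<nu>"
  proof
    show "tilde_A2 \<mu> \<subseteq> A2 ?\<nu>"
    proof
      fix f assume "f \<in> tilde_A2 \<mu>"
      then obtain g where g: "g \<in> X \<mu>" "f = inv_fourier g" by (auto simp: tilde_A2_def)
      have "ennreal C * X_normsq \<mu> g < \<infinity>" using g(1) by (auto simp: X_def ennreal_mult_less_top)
      then have "A2_normsq ?\<nu> f < \<infinity>" using equiv(2)[OF g(1)] g(2) by (auto intro: le_less_trans)
      then show "f \<in> A2 ?\<nu>" using inv_fourier_Hol[OF assms g(1)] g(2) by (simp add: A2_def)
    qed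
    show "A2 ?\<nu> \<subseteq> tilde_A2 \<mu>"
    proof
      fix f assume f: "f \<in> A2 ?\<nu>"
      obtain g where sq: "\<And>n. sq_int (\<lambda>t. g t * of_real (mult_q t) ^ n)"
        and fg: "\<And>m n. f (m, n) = fcoef (\<lambda>t. g t * of_real (mult_q t) ^ n) m"
        using A2_symbol[OF f] by metis
      have m: "g \<in> borel_measurable circ" using sq[of 0] by (simp add: sq_int_def)
      have "(\<integral>\<^sup>+t. ennreal ((cmod (g t))\<^sup>2) * weight_sum \<mu> t \<partial>circ) = A2_normsq ?\<nu> f"
        using A2_normsq_eq[OF m sq, of f \<mu>] fg by simp
      then have fin: "(\<integral>\<^sup>+t. ennreal ((cmod (g t))\<^sup>2) * weight_sum \<mu> t \<partial>circ) < \<infinity>"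
        using f by (simp add: A2_def)
      \<comment> \<open>A finite integral has an integrand finite almost everywhere; where the
        weight is infinite, this leaves only \<open>g t = 0\<close>.\<close>
      then have "AE t in circ. ennreal ((cmod (g t))\<^sup>2) * weight_sum \<mu> t \<noteq> \<infinity>"
        by (intro nn_integral_PInf_AE borel_measurable_times_ennreal norm_sq_measurable[OF m]
          borel_imp_circ_measurable[OF weight_sum_measurable]) auto
      then have "AE t in circ. t \<in> {-pi<..<0} \<and> t \<noteq> - (pi / 2) \<longrightarrow> g t = 0"
        by eventually_elim (auto simp: top ennreal_mult_eq_top_iff)
      then have g0: "AE t in circ. t \<in> {-pi<..<0} \<longrightarrow> g t = 0"
        using AE_circ_neq[of "- (pi / 2)"] by eventually_elim auto
      have "AE t in circ. (t \<in> {-pi<..<0} \<longrightarrow> g t = 0) \<longrightarrow> g t = half_cut g t"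
        by (rule AE_circ_cases) (auto simp: half_cut_def)
      then have gcut: "AE t in circ. g t = half_cut g t" using g0 by eventually_elim blast
      have "X_normsq \<mu> g < \<infinity>"
      proof -
        have "ennreal c * X_normsq \<mu> g \<le> (\<integral>\<^sup>+t. ennreal ((cmod (half_cut g t))\<^sup>2) * weight_sum \<mu> t \<partial>circ)"
          by (rule cut_lo[OF m])
        also have "\<dots> = (\<integral>\<^sup>+t. ennreal ((cmod (g t))\<^sup>2) * weight_sum \<mu> t \<partial>circ)"
          using gcut by (intro nn_integral_cong_AE) auto
        finally have "ennreal c * X_normsq \<mu> g < \<infinity>" using fin by (rule le_less_trans)
        then show ?thesis using c(1) by (auto simp: ennreal_mult_less_top)
      qed
      moreover have "AE t in lebesgue. t \<in> {-pi<..<0} \<longrightarrow> g t = 0"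
        using g0 by (subst (asm) AE_restrict_space_iff) (auto elim!: eventually_mono)
      ultimately have "g \<in> X \<mu>" using m by (simp add: X_def)
      moreover have "f (m, n) = inv_fourier g (m, n)" for m n
        unfolding fg inv_fourier_eq_fcoef
      proof (rule fcoef_cong_AE)
        show "AE t in circ. g t * of_real (mult_q t) ^ n = half_cut g t * of_real (mult_q t) ^ n"
          using gcut by eventually_elim simp
      qed (intro borel_measurable_times mult_q_power_measurable m half_cut_measurable[OF m])+
      then have "f = inv_fourier g" by (auto simp: fun_eq_iff)
      ultimately show "f \<in> tilde_A2 \<mu>" by (auto simp: tilde_A2_def)
    qed
  qed
  \<comment> \<open>Solving for the norm of the symbol swaps the constants: the upper bound by
    \<open>C\<close> yields the lower estimate, the lower bound by \<open>c\<close> the upper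
    one.\<close>
  moreover have "1 / sqrt C * A2_norm ?\<nu> f \<le> tilde_A2_norm \<mu> f \<and> tilde_A2_norm \<mu> f \<le> 1 / sqrt c * A2_norm ?\<nu> f"
    if "f \<in> tilde_A2 \<mu>" for f
  proof -
    define g where "g = (SOME g. g \<in> X \<mu> \<and> f = inv_fourier g)"
    have "\<exists>g. g \<in> X \<mu> \<and> f = inv_fourier g" using that by (auto simp: tilde_A2_def)
    then have g: "g \<in> X \<mu>" "f = inv_fourier g" unfolding g_def by (metis (mono_tags, lifting) someI_ex)+
    obtain x where x: "X_normsq \<mu> g = ennreal x" "x \<ge> 0"
      using g(1) by (cases "X_normsq \<mu> g") (auto simp: X_def)
    have "A2_normsq ?\<nu> f \<le> ennreal (C * x)" "ennreal (c * x) \<le> A2_normsq ?\<nu> f"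
      using equiv[OF g(1)] x c g(2) by (auto simp: ennreal_mult)
    then obtain y where y: "A2_normsq ?\<nu> f = ennreal y" "y \<ge> 0" "y \<le> C * x" "c * x \<le> y"
      using c x by (cases "A2_normsq ?\<nu> f") (auto simp: top_unique)
    have "sqrt y \<le> sqrt (C * x)" "sqrt (c * x) \<le> sqrt y" using y by auto
    then have "sqrt y \<le> sqrt x * sqrt C" "sqrt x * sqrt c \<le> sqrt y" by (auto simp: real_sqrt_mult mult.commute)
    moreover have "A2_norm ?\<nu> f = sqrt y" "tilde_A2_norm \<mu> f = sqrt x"
      using x y by (auto simp: A2_norm_def tilde_A2_norm_def X_norm_def g_def[symmetric])
    ultimately show ?thesis using c by (simp add: pos_divide_le_eq pos_le_divide_eq)
  qed
  moreover have "1 / sqrt C > 0" "1 / sqrt c > 0" using c by auto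
  ultimately show ?thesis by blast
qed

end
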